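(* Up to isomorphism, the only free non-abelian group among the groups generated by $3$-state invertible automata over a $2$-letter alphabet is the free group of rank $3$, which is generated by the Aleshin–Vorobets automaton $\mathcal A_{2240}$, given by $a=\sigma(b,c)$, $b=\sigma(c,b)$, $c=(a,a)$. Moreover, for a $3$-state invertible automaton $A$ over a $2$-letter alphabet, the group $G(A)$ is isomorphic to $G(\mathcal A_{2240})$ if and only if $A$ is symmetric to $\mathcal A_{2240}$.
   Context: Let $X=\{0,1\}$ and let $X^*$ be the set of finite words over $X$, viewed as the rooted binary tree. Let $\sigma$ be the transposition $(01)$ of $X$. An invertible automaton with $3$ states $a,b,c$ over $X$ is given by a system of three relations $q=\sigma^{i_q}(q_0,q_1)$, one for each state $q$, where $i_q\in\{0,1\}$ and $q_0,q_1\in\{a,b,c\}$ (we write $q=(q_0,q_1)$ if $i_q=0$ and $q=\sigma(q_0,q_1)$ if $i_q=1$). Each state $q$ defines an automorphism of the tree $X^*$, recursively by $q(\emptyset)=\emptyset$ and $q(xw)=\sigma^{i_q}(x)\,q_x(w)$ for $x\in X$, $w\in X^*$. The automaton group $G(A)$ is the subgroup of $\mathrm{Aut}(X^* )$ generated by the three states. Two automata are called symmetric if one can be obtained from the other by a composition of the following operations: (i) passing to the inverses of all generators, i.e. replacing the automaton by the automaton whose states are the inverses $q^{-1}$ of the original states (so $q=(q_0,q_1)$ becomes $q^{-1}=(q_0^{-1},q_1^{-1})$ and $q=\sigma(q_0,q_1)$ becomes $q^{-1}=\sigma(q_1^{-1},q_0^{-1})$); (ii) permuting (renaming) the states of the automaton;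 (iii) permuting the letters of the alphabet. *)

theory Defs
  imports "HOL-Algebra.Algebra"
begin

text \<open>The letters 0 and 1 are encoded as \<^term>\<open>False\<close> and \<^term>\<open>True\<close>, so that the transposition
  \<open>\<sigma>\<close> is negation; \<open>A q = (i, q0, q1)\<close> encodes the relation \<open>q = \<sigma>\<^sup>i(q0, q1)\<close>.\<close>

datatype state = Sa | Sb | Sc

type_synonym automaton = "state \<Rightarrow> bool \<times> state \<times> state"

fun act :: "automaton \<Rightarrow> state \<Rightarrow> bool list \<Rightarrow> bool list" where
  "act A q [] = []"
| "act A q (x # w) =
    (case A q of (i, q0, q1) \<Rightarrow>
      (if i then \<not> x else x) # act A (if x then q1 else q0) w)"

definition tree_child :: "bool list \<Rightarrow> bool list \<Rightarrow> bool" where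
  "tree_child v w \<longleftrightarrow> (\<exists>x. w = v @ [x])"

definition tree_aut :: "(bool list \<Rightarrow> bool list) monoid" where
  "tree_aut =
    \<lparr>carrier = {f. bij f \<and> f [] = [] \<and> (\<forall>v w. tree_child (f v) (f w) \<longleftrightarrow> tree_child v w)},
     monoid.mult = (\<circ>), one = id\<rparr>"

definition automaton_group :: "automaton \<Rightarrow> (bool list \<Rightarrow> bool list) monoid" where
  "automaton_group A = subgroup_generated tree_aut (range (act A))"

fun aleshin_vorobets :: automaton where
  "aleshin_vorobets Sa = (True, Sb, Sc)"
| "aleshin_vorobets Sb = (True, Sc, Sb)"
| "aleshin_vorobets Sc = (False, Sa, Sa)"


definition inverse_automaton :: "automaton \<Rightarrow> automaton" where
  "inverse_automaton A =
    (\<lambda>q. case A q of (i, q0, q1) \<Rightarrow> if i then (True, q1, q0) else (False, q0, q1))"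

definition rename_states :: "(state \<Rightarrow> state) \<Rightarrow> automaton \<Rightarrow> automaton" where
  "rename_states \<pi> A = (\<lambda>q. case A (inv_into UNIV \<pi> q) of (i, q0, q1) \<Rightarrow> (i, \<pi> q0, \<pi> q1))"

text \<open>Exchanging the letters 0 and 1 conjugates \<open>\<sigma>\<^sup>i\<close> by \<open>\<sigma>\<close>, hence leaves \<open>i\<close> unchanged.\<close>

definition swap_letters :: "automaton \<Rightarrow> automaton" where
  "swap_letters A = (\<lambda>q. case A q of (i, q0, q1) \<Rightarrow> (i, q1, q0))"

inductive symmetry_step :: "automaton \<Rightarrow> automaton \<Rightarrow> bool" where
  inverse: "symmetry_step A (inverse_automaton A)"
| rename: "bij \<pi> \<Longrightarrow> symmetry_step A (rename_states \<pi> A)"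
| swap: "symmetry_step A (swap_letters A)"

definition symmetric_automata :: "automaton \<Rightarrow> automaton \<Rightarrow> bool" where
  "symmetric_automata = symmetry_step\<^sup>*\<^sup>*"


text \<open>The free group on \<open>S\<close> consists of the reduced words over \<open>S\<close> and formal inverses of elements
  of \<open>S\<close>: \<open>(True, s)\<close> stands for \<open>s\<close> and \<open>(False, s)\<close> for its inverse. The product
  is concatenation followed by cancellation, one letter of the left factor at a time.\<close>

type_synonym 'a signed = "bool \<times> 'a"

definition inv_letter :: "'a signed \<Rightarrow> 'a signed" where
  "inv_letter x = (\<not> fst x, snd x)"

definition reduced :: "'a signed list \<Rightarrow> bool" where
  "reduced w \<longleftrightarrow> (\<forall>i. Suc i < length w \<longrightarrow> w ! Suc i \<noteq> inv_letter (w ! i))"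

fun prepend :: "'a signed \<Rightarrow> 'a signed list \<Rightarrow> 'a signed list" where
  "prepend x [] = [x]"
| "prepend x (y # w) = (if y = inv_letter x then w else x # y # w)"

definition free_group :: "'a set \<Rightarrow> 'a signed list monoid" where
  "free_group S =
    \<lparr>carrier = {w. reduced w \<and> snd ` set w \<subseteq> S}, monoid.mult = foldr prepend, one = []\<rparr>"

text \<open>A basis of \<open>G\<close> is a subset of the carrier of \<open>G\<close>, so taking the basis \<open>S\<close> in the element
  type of \<open>G\<close> is no restriction.\<close>

definition is_free_group :: "('a, 'b) monoid_scheme \<Rightarrow> bool" where
  "is_free_group G \<longleftrightarrow> (\<exists>S :: 'a set. G \<cong> free_group S)"


lemma group_tree_aut: "group tree_aut"
proof (rule groupI)
  fix f assume f: "f \<in> carrier tree_aut"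
  then have b: "bij f" by (simp add: tree_aut_def)
  have "inv_into UNIV f \<in> carrier tree_aut"
  proof -
    have "tree_child (inv_into UNIV f v) (inv_into UNIV f w) \<longleftrightarrow> tree_child v w" for v w
    proof -
      have "tree_child (f (inv_into UNIV f v)) (f (inv_into UNIV f w))
          \<longleftrightarrow> tree_child (inv_into UNIV f v) (inv_into UNIV f w)"
        using f by (simp add: tree_aut_def)
      then show ?thesis using b by (simp add: bij_is_surj surj_f_inv_f)
    qed
    moreover have "inv_into UNIV f [] = []"
      using f b by (auto simp: tree_aut_def bij_is_inj intro!: inv_f_eq)
    ultimately show ?thesis using b by (simp add: tree_aut_def bij_imp_bij_inv)
  qed
  moreover have "inv_into UNIV f \<circ> f = id" using b by (simp add: bij_is_inj)
  ultimately show "\<exists>g\<in>carrier tree_aut. g \<otimes>\<^bsub>tree_aut\<^esub> f = \<one>\<^bsub>tree_aut\<^esub>"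
    by (auto simp: tree_aut_def)
qed (auto simp: tree_aut_def bij_comp comp_assoc)

lemma length_act [simp]: "length (act A q w) = length w"
  by (induction w arbitrary: q) (auto split: prod.splits)

lemma act_inverse: "act (inverse_automaton A) q (act A q w) = w"
  by (induction w arbitrary: q) (auto simp: inverse_automaton_def split: prod.splits)

lemma inverse_automaton_involution: "inverse_automaton (inverse_automaton A) = A"
  by (auto simp: inverse_automaton_def fun_eq_iff split: prod.splits)

lemma act_append: "\<exists>r. act A q (v @ w) = act A q v @ act A r w"
  by (induction v arbitrary: q) (auto split: prod.splits)

lemma act_child: "tree_child v w \<Longrightarrow> tree_child (act A q v) (act A q w)"
proof -
  assume "tree_child v w"
  then obtain x where w: "w = v @ [x]" by (auto simp: tree_child_def)
  obtain r where "act A q w = act A q v @ act A r [x]" using act_append w by blast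
  then show ?thesis by (auto simp: tree_child_def split: prod.splits)
qed

lemma act_in_tree_aut: "act A q \<in> carrier tree_aut"
proof -
  have r: "act A q (act (inverse_automaton A) q w) = w" for w
    using act_inverse[of "inverse_automaton A"] by (simp add: inverse_automaton_involution)
  have "bij (act A q)"
    by (rule o_bij[of "act (inverse_automaton A) q"]) (auto simp: act_inverse r)
  moreover have "tree_child v w" if "tree_child (act A q v) (act A q w)" for v w
    using act_child[OF that, of "inverse_automaton A" q] by (simp add: act_inverse)
  ultimately show ?thesis by (auto simp: tree_aut_def intro: act_child)
qed

lemma act_rename: "bij \<pi> \<Longrightarrow> act (rename_states \<pi> A) (\<pi> q) w = act A q w"
  by (induction w arbitrary: q)
    (auto simp: rename_states_def bij_is_inj split: prod.splits)

lemma act_swap: "act (swap_letters A) q (map Not w) = map Not (act A q w)"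
  by (induction w arbitrary: q) (auto simp: swap_letters_def split: prod.splits)

lemma symmetric_automata_sym: "symmetric_automata A B \<Longrightarrow> symmetric_automata B A"
proof -
  have "symmetry_step B A" if "symmetry_step A B" for A B
    using that
  proof cases
    case inverse
    then show ?thesis
      using symmetry_step.inverse[of B] by (simp add: inverse_automaton_involution)
  next
    case (rename \<pi>)
    then have "rename_states (inv_into UNIV \<pi>) B = A"
      by (auto simp: rename_states_def fun_eq_iff bij_is_inj inv_inv_eq split: prod.splits)
    then show ?thesis
      using symmetry_step.rename[of "inv_into UNIV \<pi>" B] rename by (simp add: bij_imp_bij_inv)
  next
    case swap
    then have "swap_letters B = A" by (auto simp: swap_letters_def fun_eq_iff split: prod.splits)
    then show ?thesis using symmetry_step.swap[of B] by simp
  qed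
  then have "symp symmetry_step" by (auto intro: sympI)
  then show "symmetric_automata A B \<Longrightarrow> symmetric_automata B A"
    unfolding symmetric_automata_def by (metis sympD symp_rtranclp)
qed

lemma inv_letter_inv_letter [simp]: "inv_letter (inv_letter x) = x"
  by (simp add: inv_letter_def)

lemma reduced_Nil [simp]: "reduced []"
  by (simp add: reduced_def)

lemma reduced_Cons:
  "reduced (x # w) \<longleftrightarrow> reduced w \<and> (case w of [] \<Rightarrow> True | y # _ \<Rightarrow> y \<noteq> inv_letter x)"
  by (cases w) (auto simp: reduced_def nth_Cons split: nat.splits)

lemma reduced_prepend: "reduced w \<Longrightarrow> reduced (prepend x w)"
  by (cases w) (auto simp: reduced_Cons)

lemma prepend_cancel: "reduced w \<Longrightarrow> prepend x (prepend (inv_letter x) w) = w"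
  by (cases w; cases "tl w") (auto simp: reduced_Cons)

lemma reduced_foldr_prepend: "reduced w \<Longrightarrow> reduced (foldr prepend u w)"
  by (induction u) (auto intro: reduced_prepend)

lemma foldr_prepend_prepend:
  "reduced w \<Longrightarrow> foldr prepend (prepend x u) w = prepend x (foldr prepend u w)"
  by (cases u) (auto simp: prepend_cancel reduced_foldr_prepend)

lemma foldr_prepend_assoc:
  "reduced w \<Longrightarrow>
    foldr prepend (foldr prepend u v) w = foldr prepend u (foldr prepend v w)"
  by (induction u) (auto simp: foldr_prepend_prepend)

lemma foldr_prepend_reduced: "reduced u \<Longrightarrow> foldr prepend u [] = u"
proof (induction u)
  case (Cons x u)
  then show ?case by (cases u) (simp_all add: reduced_Cons)
qed simp

lemma letters_foldr_prepend:
  "snd ` set (foldr prepend u v) \<subseteq> snd ` set u \<union> snd ` set v"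
proof (induction u)
  case (Cons x u)
  have "set (prepend x w) \<subseteq> insert x (set w)" for w by (cases w) auto
  then have "set (prepend x (foldr prepend u v)) \<subseteq> insert x (set (foldr prepend u v))" .
  then have "snd ` set (prepend x (foldr prepend u v)) \<subseteq> snd ` insert x (set (foldr prepend u v))"
    by (rule image_mono)
  also have "\<dots> \<subseteq> insert (snd x) (snd ` set u \<union> snd ` set v)"
    using Cons by (simp only: image_insert) (rule insert_mono)
  finally show ?case by simp
qed auto

lemma group_free_group: "group (free_group S)"
proof (rule groupI)
  fix u assume u: "u \<in> carrier (free_group S)"
  define v where "v = foldr prepend (rev (map inv_letter u)) []"
  have "snd ` set (rev (map inv_letter u)) = snd ` set u"
    by (simp add: inv_letter_def image_image)
  then have "snd ` set v \<subseteq> snd ` set u"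
    using letters_foldr_prepend[of "rev (map inv_letter u)" "[]"] by (simp add: v_def)
  also have "\<dots> \<subseteq> S" using u by (simp add: free_group_def)
  finally have "v \<in> carrier (free_group S)"
    by (simp add: free_group_def v_def reduced_foldr_prepend)
  moreover have "foldr prepend (rev (map inv_letter u)) (foldr prepend u w) = w"
    if "reduced w" for w
  proof (induction u)
    case (Cons x u)
    then show ?case
      using prepend_cancel[OF reduced_foldr_prepend[OF that], of "inv_letter x"] by simp
  qed simp
  then have "foldr prepend v u = []"
    using u foldr_prepend_reduced[of u] foldr_prepend_assoc[of u _ "[]"]
    by (metis (mono_tags, lifting) foldr.simps(1) free_group_def id_apply mem_Collect_eq
        partial_object.select_convs(1) reduced_Nil v_def)
  ultimately show "\<exists>v\<in>carrier (free_group S). v \<otimes>\<^bsub>free_group S\<^esub> u = \<one>\<^bsub>free_group S\<^esub>"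
    by (auto simp: free_group_def)
next
  fix u v assume "u \<in> carrier (free_group S)" "v \<in> carrier (free_group S)"
  then have "reduced v" "snd ` set u \<union> snd ` set v \<subseteq> S" by (simp_all add: free_group_def)
  then show "u \<otimes>\<^bsub>free_group S\<^esub> v \<in> carrier (free_group S)"
    using order_trans[OF letters_foldr_prepend[of u v]]
    by (simp add: free_group_def reduced_foldr_prepend)
qed (auto simp: free_group_def foldr_prepend_assoc)

end

theory Submission
  imports Defs
begin

text \<open>
  The Aleshin--Vorobets generators are \<open>a = \<tau> A\<close>, \<open>b = \<tau> B\<close>, \<open>c = \<tau> C\<close>, where
  \<open>\<tau> = \<sigma>(\<tau>, \<tau>)\<close> flips every letter and \<open>A = (B, C)\<close>, \<open>B = (C, B)\<close>, \<open>C = \<sigma>(A, A)\<close>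
  are involutions. A relation between the generators gives a trivial word in \<open>A, B, C, \<tau>\<close> without
  two equal neighbours that neither starts nor ends with \<open>\<tau>\<close>. Taking sections preserves the positions
  of \<open>\<tau>\<close> and permutes the finitely many words with given positions; the action is transitive,
  so one trivial word would make all words with these positions trivial, but they do not all fix the
  first level. Transitivity is proved, by induction on the length, in the stronger form that no
  \<open>\<int>/2\<close>-valued function on these words changes under sections by a cocycle built from the constant 1,
  the first letter of the input and the activity, except the constants.

  For the other automata freeness is refuted by a relation. If all states are active or none is, the
  group is abelian. Otherwise, up to symmetry, a finite search finds for every automaton not symmetric to
  Aleshin--Vorobets one of four obstructions: the generators commute; there is 2-torsion; a nontrivial
  element acts trivially below a letter, so that some conjugate of it has disjoint support, commutes
  with it and has no power in common with it; or \<open>v w = w v\<^sup>3\<close> or \<open>v w v\<^sup>3 = w\<close> with \<open>v\<close> nontrivial.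
  Triviality of a word is certified by a finite set of inactive words closed under sections.
\<close>

section \<open>Words in the involutions\<close>

definition xor :: "bool \<Rightarrow> bool \<Rightarrow> bool"  (infixl "\<diamond>" 65) where
  "x \<diamond> y \<longleftrightarrow> x \<noteq> y"

lemma xor_assoc [simp]: "(x \<diamond> y) \<diamond> z = x \<diamond> (y \<diamond> z)"
  by (auto simp: xor_def)

lemma xor_commute: "x \<diamond> y = y \<diamond> x"
  by (auto simp: xor_def)

lemma xor_left_commute: "x \<diamond> (y \<diamond> z) = y \<diamond> (x \<diamond> z)"
  by (auto simp: xor_def)

lemmas xor_ac = xor_assoc xor_commute xor_left_commute

lemma xor_simps [simp]:
  "x \<diamond> False = x" "False \<diamond> x = x" "x \<diamond> x = False" "x \<diamond> (x \<diamond> y) = y"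
  "True \<diamond> x = (\<not> x)" "x \<diamond> True = (\<not> x)" "\<not> x \<diamond> y = (\<not> (x \<diamond> y))" "x \<diamond> (\<not> y) = (\<not> (x \<diamond> y))"
  by (auto simp: xor_def)

datatype letter = LA | LB | LC | LT

text \<open>\<open>LA, LB, LC, LT\<close> stand for \<open>A, B, C, \<tau>\<close>. In a product the last letter acts first.\<close>

fun nxt :: "letter \<Rightarrow> letter" where
  "nxt LA = LB" | "nxt LB = LC" | "nxt LC = LA" | "nxt LT = LT"

fun prv :: "letter \<Rightarrow> letter" where
  "prv LA = LC" | "prv LB = LA" | "prv LC = LB" | "prv LT = LT"

definition flips :: "letter \<Rightarrow> bool" where
  "flips L \<longleftrightarrow> L = LC \<or> L = LT"

fun lsec :: "letter \<Rightarrow> bool \<Rightarrow> letter" where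
  "lsec LA s = (if s then LC else LB)"
| "lsec LB s = (if s then LB else LC)"
| "lsec LC s = LA"
| "lsec LT s = LT"

fun par :: "letter list \<Rightarrow> bool" where
  "par [] = False"
| "par (L # w) = (flips L \<diamond> par w)"

fun sect :: "bool \<Rightarrow> letter list \<Rightarrow> letter list" where
  "sect s [] = []"
| "sect s (L # w) = lsec L (s \<diamond> par w) # sect s w"

text \<open>An entry of \<open>p\<close> tells whether \<open>LT\<close> separates two consecutive letters other than \<open>LT\<close>; letters that
  are not separated have to differ.\<close>

fun W :: "bool list \<Rightarrow> letter list set" where
  "W [] = {[LA], [LB], [LC]}"
| "W (False # p) = {L # w |L w. w \<in> W p \<and> L \<noteq> LT \<and> L \<noteq> hd w}"
| "W (True # p) = {L # LT # w |L w. w \<in> W p \<and> L \<noteq> LT}"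

lemma flips_simps [simp]: "\<not> flips LA" "\<not> flips LB" "flips LC" "flips LT"
  by (auto simp: flips_def)

lemma lsec_eq_LT [simp]: "lsec L s = LT \<longleftrightarrow> L = LT"
  by (cases L) auto

lemma nxt_eq_LT [simp]: "nxt L = LT \<longleftrightarrow> L = LT" "prv L = LT \<longleftrightarrow> L = LT"
  by (cases L; auto)+

lemma nxt_neq: "L \<noteq> LT \<Longrightarrow> nxt L \<noteq> L" "L \<noteq> LT \<Longrightarrow> prv L \<noteq> L" "L \<noteq> LT \<Longrightarrow> nxt L \<noteq> prv L"
  by (cases L; auto)+

text \<open>An unseparated neighbour of \<open>Y\<close> is thereby encoded by one bit, its
  direction in the cyclic order A, B, C.\<close>

lemma letter_nbrs: "L \<noteq> LT \<Longrightarrow> Y \<noteq> LT \<Longrightarrow> L \<noteq> Y \<longleftrightarrow> L = nxt Y \<or> L = prv Y"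
  by (cases L; cases Y; auto)

lemma W_nonempty: "w \<in> W p \<Longrightarrow> w \<noteq> [] \<and> hd w \<noteq> LT \<and> last w \<noteq> LT"
proof (induction p arbitrary: w rule: W.induct)
  case (2 p)
  then obtain L v where v: "w = L # v" "v \<in> W p" "L \<noteq> LT" by auto
  then show ?case using 2(1)[of v] by auto
next
  case (3 p)
  then obtain L v where v: "w = L # LT # v" "v \<in> W p" "L \<noteq> LT" by auto
  then show ?case using 3(1)[of v] by auto
qed auto

lemma W_ex: "\<exists>w. w \<in> W p"
proof (induction p rule: W.induct)
  case (2 p)
  then obtain w where w: "w \<in> W p" by blast
  have "nxt (hd w) # w \<in> W (False # p)" using w W_nonempty[OF w] by (auto simp: nxt_neq)
  then show ?case by blast
next
  case (3 p)
  then obtain w where w: "w \<in> W p" by blast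
  have "LA # LT # w \<in> W (True # p)" using w by auto
  then show ?case by blast
qed auto

lemma par_append [simp]: "par (v @ w) = (par v \<diamond> par w)"
  by (induction v) auto

lemma sect_append: "sect s (v @ w) = sect (s \<diamond> par w) v @ sect s w"
  by (induction v) (auto simp: xor_ac)

lemma sect_snoc: "sect s (v @ [L]) = sect (s \<diamond> flips L) v @ [lsec L s]"
  by (simp add: sect_append)

lemma sect_snoc2: "sect s (v @ [LT, L]) = sect (\<not> (s \<diamond> flips L)) v @ [LT, lsec L s]"
  by (simp add: sect_append)

lemma sect_Nil_iff [simp]: "sect s w = [] \<longleftrightarrow> w = []"
  by (cases w) auto

lemma hd_sect: "w \<noteq> [] \<Longrightarrow> hd (sect s w) = lsec (hd w) (s \<diamond> par (tl w))"
  by (cases w) auto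

text \<open>For a given word there are two letters that may be put in front of it (or behind it) without
  separation; these lemmas say when taking sections exchanges their cyclic order.\<close>

lemma lsec_nxt:
  "L \<noteq> LT \<Longrightarrow> lsec (nxt L) (t \<diamond> flips L) = (if t \<diamond> flips L then prv (lsec L t) else nxt (lsec L t))"
  "L \<noteq> LT \<Longrightarrow> lsec (prv L) (t \<diamond> flips L) = (if t \<diamond> flips L then nxt (lsec L t) else prv (lsec L t))"
  by (cases L; cases t; auto)+

lemma lsec_nxt_left:
  "L \<noteq> LT \<Longrightarrow> lsec (nxt L) (t \<diamond> flips (nxt L)) = (if t then prv (lsec L t) else nxt (lsec L t))"
  "L \<noteq> LT \<Longrightarrow> lsec (prv L) (t \<diamond> flips (prv L)) = (if t then nxt (lsec L t) else prv (lsec L t))"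
  by (cases L; cases t; auto)+

lemma sect_nxt:
  assumes "w \<noteq> []" "hd w \<noteq> LT"
  shows "sect s (nxt (hd w) # w) = (if s \<diamond> par w then prv else nxt) (hd (sect s w)) # sect s w"
    "sect s (prv (hd w) # w) = (if s \<diamond> par w then nxt else prv) (hd (sect s w)) # sect s w"
proof -
  obtain L v where w: "w = L # v" using assms by (cases w) auto
  have *: "(s \<diamond> par w) = ((s \<diamond> par v) \<diamond> flips L)" using w by (simp add: xor_ac)
  have L: "L \<noteq> LT" using assms w by simp
  show "sect s (nxt (hd w) # w) = (if s \<diamond> par w then prv else nxt) (hd (sect s w)) # sect s w"
    "sect s (prv (hd w) # w) = (if s \<diamond> par w then nxt else prv) (hd (sect s w)) # sect s w"
    unfolding sect.simps(2)[of s _ w] * lsec_nxt[OF L] w hd_sect list.sel using lsec_nxt[OF L, of "s \<diamond> par v"] by (simp_all add: xor_ac)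
qed

lemma sect_snoc_nxt:
  assumes "w \<noteq> []" "last w \<noteq> LT"
  shows "sect (t \<diamond> flips (nxt (last w))) (w @ [nxt (last w)])
      = sect t w @ [(if t then prv else nxt) (last (sect t w))]"
    "sect (t \<diamond> flips (prv (last w))) (w @ [prv (last w)])
      = sect t w @ [(if t then nxt else prv) (last (sect t w))]"
proof -
  obtain L v where w: "w = v @ [L]" using assms by (cases w rule: rev_cases) auto
  have *: "((t \<diamond> f) \<diamond> f) = t" for f by auto
  show "sect (t \<diamond> flips (nxt (last w))) (w @ [nxt (last w)])
      = sect t w @ [(if t then prv else nxt) (last (sect t w))]"
    "sect (t \<diamond> flips (prv (last w))) (w @ [prv (last w)])
      = sect t w @ [(if t then nxt else prv) (last (sect t w))]"
    using lsec_nxt_left[of L t] assms unfolding sect_snoc[of _ w] * using w by (simp_all add: sect_snoc)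
qed

text \<open>An unseparated neighbour is \<open>nxt\<close> or \<open>prv\<close> of the letter
  behind it, and sections at most exchange these two directions, while \<open>LT\<close> is its own
  section. So the pattern survives.\<close>

lemma sect_W: "w \<in> W p \<Longrightarrow> sect s w \<in> W p"
proof (induction p arbitrary: w rule: W.induct)
  case 1
  then show ?case by (auto split: if_splits)
next
  case (2 p)
  then obtain L v where v: "w = L # v" "v \<in> W p" "L \<noteq> LT" "L \<noteq> hd v" by auto
  note n = W_nonempty[OF v(2)]
  have "sect s v \<in> W p" using 2(1) v by auto
  note m = W_nonempty[OF this]
  have "L = nxt (hd v) \<or> L = prv (hd v)" using v n letter_nbrs by auto
  then show ?case using v n m \<open>sect s v \<in> W p\<close> sect_nxt[of v s] nxt_neq[of "hd (sect s v)"] by (auto split: if_splits)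
next
  case (3 p)
  then show ?case by auto
qed

text \<open>\<open>W\<close> grows at the left end, but the rigidity arguments also remove last
  letters; this and the next lemma unfold the pattern from the right.\<close>

lemma W_snoc_True: "W (p @ [True]) = {w @ [LT, L] |w L. w \<in> W p \<and> L \<noteq> LT}"
proof (induction p rule: W.induct)
  case 1
  show ?case by (auto intro: letter.exhaust)
next
  case (2 p)
  have "w \<in> W ((False # p) @ [True]) \<longleftrightarrow> w \<in> {w @ [LT, L] |w L. w \<in> W (False # p) \<and> L \<noteq> LT}" for w
    using W_nonempty[of _ p] by (auto simp: 2 Cons_eq_append_conv) 
  then show ?case by blast
next
  case (3 p)
  have "w \<in> W ((True # p) @ [True]) \<longleftrightarrow> w \<in> {w @ [LT, L] |w L. w \<in> W (True # p) \<and> L \<noteq> LT}" for w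
    using W_nonempty[of _ p] by (auto simp: 3 Cons_eq_append_conv)
  then show ?case by blast
qed

lemma W_snoc_False: "W (p @ [False]) = {w @ [L] |w L. w \<in> W p \<and> L \<noteq> LT \<and> L \<noteq> last w}"
proof (induction p rule: W.induct)
  case 1
  show ?case by (auto intro: letter.exhaust)
next
  case (2 p)
  have "w \<in> W ((False # p) @ [False]) \<longleftrightarrow>
     w \<in> {w @ [L] |w L. w \<in> W (False # p) \<and> L \<noteq> LT \<and> L \<noteq> last w}" for w
    using W_nonempty[of _ p] by (auto simp: 2 Cons_eq_append_conv)
  then show ?case by blast
next
  case (3 p)
  have "w \<in> W ((True # p) @ [False]) \<longleftrightarrow>
     w \<in> {w @ [L] |w L. w \<in> W (True # p) \<and> L \<noteq> LT \<and> L \<noteq> last w}" for w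
    using W_nonempty[of _ p] by (auto simp: 3 Cons_eq_append_conv)
  then show ?case by blast
qed

lemma finite_W: "finite (W p)"
proof (induction p rule: W.induct)
  case (2 p)
  have u: "(UNIV :: letter set) = {LA, LB, LC, LT}" by (auto intro: letter.exhaust)
  have "W (False # p) \<subseteq> (\<lambda>(L, w). L # w) ` (UNIV \<times> W p)" by auto
  then show ?case using 2 u by (metis finite.emptyI finite.insertI finite_SigmaI finite_imageI finite_subset)
next
  case (3 p)
  have u: "(UNIV :: letter set) = {LA, LB, LC, LT}" by (auto intro: letter.exhaust)
  have "W (True # p) \<subseteq> (\<lambda>(L, w). L # LT # w) ` (UNIV \<times> W p)" by auto
  then show ?case using 3 u by (metis finite.emptyI finite.insertI finite_SigmaI finite_imageI finite_subset)
qed auto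

text \<open>By induction the tails agree, hence also the bits that reach the first letters, and for
  a fixed bit \<open>lsec\<close> is injective. Thus \<open>sect s\<close> permutes the finite set
  \<open>W p\<close>.\<close>

lemma sect_inj: "sect s v = sect s w \<Longrightarrow> v = w"
proof (induction v arbitrary: w)
  case (Cons L v)
  then obtain Y u where w: "w = Y # u" by (cases w) auto
  then have "v = u" using Cons by auto
  moreover have "lsec L t = lsec Y t \<Longrightarrow> L = Y" for t by (cases L; cases Y; cases t; auto)
  ultimately show ?case using Cons w by auto
qed (metis sect_Nil_iff)

section \<open>Cocycles on the words with a given pattern, and their rigidity\<close>

definition cocycle :: "bool list \<Rightarrow> (letter list \<Rightarrow> bool) \<Rightarrow> bool \<Rightarrow> bool \<Rightarrow> bool \<Rightarrow> bool" where
  "cocycle p F a b c \<longleftrightarrow>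
    (\<forall>w\<in>W p. \<forall>s. F (sect s w) = F w \<diamond> (a \<diamond> ((b \<and> s) \<diamond> (c \<and> par w))))"

text \<open>For zero coefficients this is transitivity of the sections on \<open>W p\<close>. The
  rest says that no nonzero combination of 1, the input letter and the activity is a coboundary;
  this extra strength makes the induction on \<open>p\<close> close.\<close>

definition rigid :: "bool list \<Rightarrow> bool" where
  "rigid p \<longleftrightarrow> (\<forall>F a b c. cocycle p F a b c \<longrightarrow>
     \<not> a \<and> \<not> b \<and> \<not> c \<and> (\<forall>v\<in>W p. \<forall>w\<in>W p. F v = F w))"

text \<open>The correction \<open>hd w \<noteq> LC\<close> says that exactly one of the two letters
  that may be put unseparated in front of \<open>w\<close> flips. It arises as the difference of the
  two extensions of a cocycle with coefficient \<open>c\<close>.\<close>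

definition hd_cocycle :: "bool list \<Rightarrow> (letter list \<Rightarrow> bool) \<Rightarrow> bool" where
  "hd_cocycle p G \<longleftrightarrow> (\<forall>w\<in>W p. \<forall>s. G (sect s w) = G w \<diamond> (hd w \<noteq> LC))"

lemma cocycleD: "cocycle p F a b c \<Longrightarrow> w \<in> W p \<Longrightarrow>
    F (sect s w) = F w \<diamond> (a \<diamond> ((b \<and> s) \<diamond> (c \<and> par w)))"
  by (auto simp: cocycle_def)

lemma rigidD:
  assumes "rigid p" "cocycle p F a b c"
  shows "\<not> a" "\<not> b" "\<not> c" "v \<in> W p \<Longrightarrow> w \<in> W p \<Longrightarrow> F v = F w"
  using assms unfolding rigid_def by blast+

lemma rigid_invariant:
  assumes "rigid p" "\<And>w s. w \<in> W p \<Longrightarrow> (F (sect s w) :: bool) = F w" "v \<in> W p" "w \<in> W p"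
  shows "F v = F w"
proof -
  have "cocycle p F False False False" using assms by (simp add: cocycle_def)
  then show ?thesis using rigidD(4) assms by blast
qed

lemma flips_nxt: "L \<noteq> LT \<Longrightarrow> flips (nxt L) = (L = LB)" "L \<noteq> LT \<Longrightarrow> flips (prv L) = (L = LA)"
  by (cases L; simp)+

lemma nxt_mem_W:
  assumes "w \<in> W p"
  shows "nxt (hd w) # w \<in> W (False # p)" "prv (hd w) # w \<in> W (False # p)"
  using assms W_nonempty[OF assms] by (auto simp: nxt_neq)

lemma snoc_nxt_mem_W:
  assumes "w \<in> W p"
  shows "w @ [nxt (last w)] \<in> W (p @ [False])" "w @ [prv (last w)] \<in> W (p @ [False])"
  using assms W_nonempty[OF assms] by (auto simp: nxt_neq W_snoc_False)

lemma rigid_Nil: "rigid []"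
  unfolding rigid_def cocycle_def by (auto simp: xor_def)

lemma not_hd_cocycle_Nil: "\<not> hd_cocycle [] G"
  unfolding hd_cocycle_def by (auto simp: xor_def)

text \<open>The two one-letter extensions of a word in \<open>W p\<close> turn \<open>F\<close> into two functions \<open>P\<close> and \<open>R\<close> on \<open>W p\<close>;
  their sum is a cocycle too, and if it is constant then \<open>P\<close> is one.\<close>

lemma rigid_FalseI:
  assumes rig: "rigid p" and hd: "(\<exists>q. p = False # q) \<or> (\<forall>G. \<not> hd_cocycle p G)"
  shows "rigid (False # p)"
  unfolding rigid_def
proof (intro allI impI)
  fix F a b c assume co: "cocycle (False # p) F a b c"
  define P R where "P w = F (nxt (hd w) # w)" and "R w = F (prv (hd w) # w)" for w
  \<comment> \<open>Prefixing commutes with sections except that \<open>nxt\<close> and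
    \<open>prv\<close> are exchanged when the bit reaching the new letter,
    \<open>s \<diamond> par w\<close>, is 1.\<close>
  have shift:
    "P (sect s w) = (if s \<diamond> par w then R w else P w) \<diamond> (a \<diamond> ((b \<and> s) \<diamond> (c \<and> (par w \<diamond> (hd w = (if s \<diamond> par w then LA else LB))))))"
    "R (sect s w) = (if s \<diamond> par w then P w else R w) \<diamond> (a \<diamond> ((b \<and> s) \<diamond> (c \<and> (par w \<diamond> (hd w = (if s \<diamond> par w then LB else LA))))))"
    if w: "w \<in> W p" for w s
  proof -
    have ne: "w \<noteq> []" "hd w \<noteq> LT" using W_nonempty[OF w] by auto
    note 1 = cocycleD[OF co nxt_mem_W(1)[OF w], of s, unfolded sect_nxt[OF ne]]
    note 2 = cocycleD[OF co nxt_mem_W(2)[OF w], of s, unfolded sect_nxt[OF ne]]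
    show "P (sect s w) = (if s \<diamond> par w then R w else P w) \<diamond> (a \<diamond> ((b \<and> s) \<diamond> (c \<and> (par w \<diamond> (hd w = (if s \<diamond> par w then LA else LB))))))"
      "R (sect s w) = (if s \<diamond> par w then P w else R w) \<diamond> (a \<diamond> ((b \<and> s) \<diamond> (c \<and> (par w \<diamond> (hd w = (if s \<diamond> par w then LB else LA))))))"
      using 1 2 ne unfolding P_def R_def by (simp_all add: flips_nxt xor_ac split: if_splits)
  qed
  define G where "G w = P w \<diamond> R w" for w
  have G: "G (sect s w) = G w \<diamond> (c \<and> hd w \<noteq> LC)" if "w \<in> W p" for w s
  proof -
    have "hd w \<noteq> LT" using W_nonempty[OF that] by auto
    then show ?thesis using shift[OF that, of s] unfolding G_def
      by (cases "hd w"; cases "s \<diamond> par w"; cases c; auto simp: xor_def)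
  qed
  have c: "\<not> c"
  proof
    assume c
    show False
      using hd
    proof
      assume "\<forall>G. \<not> hd_cocycle p G"
      then show False using G \<open>c\<close> by (auto simp: hd_cocycle_def)
    next
      assume "\<exists>q. p = False # q"
      then obtain q where q: "p = False # q" by blast
      \<comment> \<open>The direction of the first letter relative to the second changes by the
        input, the activity and \<open>hd w = LC\<close>. Added to \<open>G\<close>, it removes the
        dependence on the head and leaves a cocycle with all three coefficients 1.\<close>
      define E where "E w = (hd w = nxt (hd (tl w)))" for w
      have E: "E (sect s w) = E w \<diamond> (s \<diamond> (par w \<diamond> (hd w = LC)))" if "w \<in> W p" for w s
      proof -
        obtain L v where w: "w = L # v" "v \<in> W q" "L \<noteq> LT" "L \<noteq> hd v" using \<open>w \<in> W p\<close> q by auto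
        note n = W_nonempty[OF w(2)] W_nonempty[OF sect_W[OF w(2), of s]]
        note sn = sect_nxt[of v s] nxt_neq[of "hd (sect s v)"]
        have "L = nxt (hd v) \<or> L = prv (hd v)" using w n letter_nbrs by auto
        moreover have "flips L = (L = LC)" using w by (cases L) auto
        moreover have "E (sect s w) = (if s \<diamond> par v then L = prv (hd v) else L = nxt (hd v))"
          using calculation(1) w(1) n sn nxt_neq[of "hd v"] by (auto simp: E_def simp del: sect.simps)
        moreover have "E w = (L = nxt (hd v))" using w by (simp add: E_def)
        ultimately show ?thesis using w(1) n nxt_neq[of "hd v"] by (auto simp: xor_def split: if_splits)
      qed
      have "cocycle p (\<lambda>w. G w \<diamond> E w) True True True"
        unfolding cocycle_def using G E \<open>c\<close> by (auto simp: xor_def)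
      then show False using rigidD(1)[OF rig] by blast
    qed
  qed
  then have "cocycle p G False False False" using G by (simp add: cocycle_def)
  then have Gc: "v \<in> W p \<Longrightarrow> w \<in> W p \<Longrightarrow> G v = G w" for v w using rigidD(4)[OF rig] by blast
  obtain w0 where w0: "w0 \<in> W p" using W_ex by blast
  have "\<not> G w0"
  proof
    assume "G w0"
    then have "P w \<noteq> R w" if "w \<in> W p" for w using Gc[OF that w0] by (simp add: G_def xor_def)
    \<comment> \<open>If \<open>P\<close> and \<open>R\<close> are complementary, their exchange
      adds \<open>s \<diamond> par w\<close> to the correction, which negates \<open>b\<close> and
      turns \<open>c\<close> into 1.\<close>
    then have "cocycle p P a (\<not> b) True"
      unfolding cocycle_def using shift(1) c by (auto simp: xor_def)
    then show False using rigidD(3)[OF rig] by blast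
  qed
  then have PR: "R w = P w" if "w \<in> W p" for w using Gc[OF that w0] by (auto simp: G_def xor_def)
  then have "cocycle p P a b False"
    unfolding cocycle_def using shift(1) c by simp
  note r = rigidD[OF rig this]
  have FP: "F w = P (tl w)" if mem: "w \<in> W (False # p)" for w
  proof -
    obtain L v where w: "w = L # v" "v \<in> W p" "L \<noteq> LT" "L \<noteq> hd v" using mem by auto
    then have "L = nxt (hd v) \<or> L = prv (hd v)" using W_nonempty[OF w(2)] letter_nbrs by auto
    then show ?thesis using w PR[OF w(2)] by (auto simp: P_def R_def)
  qed
  moreover have "tl w \<in> W p" if "w \<in> W (False # p)" for w using that by auto
  ultimately have "\<forall>v\<in>W (False # p). \<forall>w\<in>W (False # p). F v = F w" using r(4) by simp
  then show "\<not> a \<and> \<not> b \<and> \<not> c \<and> (\<forall>v\<in>W (False # p). \<forall>w\<in>W (False # p). F v = F w)"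
    using r c by blast
qed

text \<open>The input is chosen so that the bit reaching \<open>w\<close>, past \<open>L\<close> and
  \<open>LT\<close>, is \<open>t\<close>.\<close>

lemma sect_snoc_T:
  "sect (\<not> (t \<diamond> flips L)) (w @ [LT, L]) = sect t w @ [LT, lsec L (\<not> (t \<diamond> flips L))]"
  by (cases t; cases "flips L"; simp add: sect_snoc2)

text \<open>Summing over the three letters behind the last \<open>LT\<close> gives a head cocycle
  for the shorter pattern: sections permute these letters, and the correction, which only concerns
  the head, is added three times.\<close>

lemma not_hd_cocycle_snoc_True:
  assumes "p = [] \<or> hd p" "\<And>G. \<not> hd_cocycle p G"
  shows "\<not> hd_cocycle (p @ [True]) G"
proof
  assume G: "hd_cocycle (p @ [True]) G"
  define S where "S w = G (w @ [LT, LA]) \<diamond> (G (w @ [LT, LB]) \<diamond> G (w @ [LT, LC]))" for w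
  have "S (sect t w) = S w \<diamond> (hd w \<noteq> LC)" if w: "w \<in> W p" for w t
  proof -
    have "G (sect t w @ [LT, lsec L (\<not> (t \<diamond> flips L))]) = G (w @ [LT, L]) \<diamond> (hd w \<noteq> LC)"
      if "L \<noteq> LT" for L
      using G that w W_nonempty[OF w] sect_snoc_T[of t L w, symmetric]
      by (auto simp: hd_cocycle_def W_snoc_True)
    from this[of LA] this[of LB] this[of LC] show ?thesis
      unfolding S_def by (cases t; auto simp: xor_def)
  qed
  then have "hd_cocycle p S" unfolding hd_cocycle_def by blast
  then show False using assms(2) by blast
qed

text \<open>By rigidity of \<open>True # q\<close> the two one-letter extensions at the right end
  differ by a constant. If they agree, they give a head cocycle for the shorter pattern; otherwise,
  summing over the free first letter leaves the bare input as correction, which rigidity of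
  \<open>q\<close> excludes.\<close>

lemma not_hd_cocycle_snoc_False:
  assumes rq: "rigid q" and rp: "rigid (True # q)" and KL: "\<And>G. \<not> hd_cocycle (True # q) G"
  shows "\<not> hd_cocycle (True # q @ [False]) G"
proof
  assume "hd_cocycle (True # q @ [False]) G"
  then have G: "hd_cocycle ((True # q) @ [False]) G" by simp
  let ?p = "True # q"
  define P R where "P w = G (w @ [nxt (last w)])" and "R w = G (w @ [prv (last w)])" for w
  have shift: "P (sect t w) = (if t then R w else P w) \<diamond> (hd w \<noteq> LC)"
     "R (sect t w) = (if t then P w else R w) \<diamond> (hd w \<noteq> LC)" if w: "w \<in> W ?p" for w t
  proof -
    note n = W_nonempty[OF w]
    note sn = sect_snoc_nxt[of w t] 
    have 1: "G (sect (t \<diamond> flips (nxt (last w))) (w @ [nxt (last w)])) = P w \<diamond> (hd w \<noteq> LC)"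
      "G (sect (t \<diamond> flips (prv (last w))) (w @ [prv (last w)])) = R w \<diamond> (hd w \<noteq> LC)"
      using G snoc_nxt_mem_W[OF w] n unfolding hd_cocycle_def P_def R_def by simp_all
    show "P (sect t w) = (if t then R w else P w) \<diamond> (hd w \<noteq> LC)"
     "R (sect t w) = (if t then P w else R w) \<diamond> (hd w \<noteq> LC)"
      using 1 sn n by (auto simp: P_def R_def simp del: W.simps split: if_splits)
  qed
  have M: "(P v \<diamond> R v) = (P w \<diamond> R w)" if "v \<in> W ?p" "w \<in> W ?p" for v w
  proof (rule rigid_invariant[OF rp, of "\<lambda>w. P w \<diamond> R w"])
    show "P (sect s w) \<diamond> R (sect s w) = P w \<diamond> R w" if "w \<in> W ?p" for w s
      using shift[OF that, of s] by (auto simp: xor_def)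
  qed (use that in auto)
  obtain w0 where w0: "w0 \<in> W ?p" using W_ex by blast
  show False
  proof (cases "P w0 \<diamond> R w0")
    case False
    then have "P w = R w" if "w \<in> W ?p" for w using M[OF that w0] by (auto simp: xor_def)
    then have "hd_cocycle ?p P" using shift(1) by (simp add: hd_cocycle_def)
    then show False using KL by blast
  next
    case True
    then have "P w \<noteq> R w" if "w \<in> W ?p" for w using M[OF that w0] by (auto simp: xor_def)
    then have P: "P (sect t w) = P w \<diamond> (t \<diamond> (hd w \<noteq> LC))" if "w \<in> W ?p" for w t
      using shift(1)[OF that, of t] that by (auto simp: xor_def)
    \<comment> \<open>The head condition holds for two of the three first letters and cancels; the
      input is added three times and remains.\<close>
    define S where "S v = P (LA # LT # v) \<diamond> (P (LB # LT # v) \<diamond> P (LC # LT # v))" for v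
    have "S (sect t v) = S v \<diamond> t" if v: "v \<in> W q" for v t
    proof -
      have "P (sect t (L # LT # v)) = P (L # LT # v) \<diamond> (t \<diamond> (L \<noteq> LC))" if "L \<noteq> LT" for L
        using P[of "L # LT # v" t] v that by simp
      from this[of LA] this[of LB] this[of LC] show ?thesis
        unfolding S_def by (cases t; cases "par v"; auto simp: xor_def)
    qed
    then have "cocycle q S False True False" by (simp add: cocycle_def)
    then show False using rigidD(2)[OF rq] by blast
  qed
qed

text \<open>Removing entries from the right keeps the leading \<open>True\<close>, so the two
  preceding lemmas lead down to the empty pattern.\<close>

lemma not_hd_cocycleI:
  assumes "\<And>q. length q < length p \<Longrightarrow> rigid q" "p = [] \<or> hd p"
  shows "\<not> hd_cocycle p G"
  using assms
proof (induction p arbitrary: G rule: rev_induct)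
  case Nil
  then show ?case using not_hd_cocycle_Nil by blast
next
  case (snoc x p)
  have IH: "\<not> hd_cocycle p G" if "p = [] \<or> hd p" for G using snoc that by force
  show ?case
  proof (cases x)
    case True
    then show ?thesis using not_hd_cocycle_snoc_True[of p] IH snoc(3) by (cases p) auto
  next
    case False
    then obtain q where p: "p = True # q" using snoc(3) by (cases p) auto
    then show ?thesis using not_hd_cocycle_snoc_False[of q] IH False snoc(2) by simp
  qed
qed

section \<open>Transitivity for patterns that begin with a separation\<close>

lemma rigid_True_Nil_const:
  assumes inv: "\<And>w s. w \<in> W [True] \<Longrightarrow> (F (sect s w) :: bool) = F w"
    and v: "v \<in> W [True]" and w: "w \<in> W [True]"
  shows "F v = F w"
proof -
  have i: "F (sect s [L, LT, Y]) = F [L, LT, Y]" if "L \<noteq> LT" "Y \<noteq> LT" for L Y s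
    using inv[of "[L, LT, Y]" s] that by (cases Y) auto
  \<comment> \<open>The sections of the nine words of this pattern connect them into a single
    orbit.\<close>
  note orbit = i[of LA LA False, simplified] i[of LA LB False, simplified] i[of LA LC False, simplified]
      i[of LB LA False, simplified] i[of LB LB False, simplified] i[of LB LC False, simplified]
      i[of LC LA False, simplified] i[of LC LB False, simplified] i[of LC LC False, simplified]
      i[of LA LA True, simplified] i[of LA LB True, simplified] i[of LA LC True, simplified]
      i[of LB LA True, simplified] i[of LB LB True, simplified] i[of LB LC True, simplified]
      i[of LC LA True, simplified] i[of LC LB True, simplified] i[of LC LC True, simplified]
  have const: "F [L, LT, Y] = F [LA, LT, LA]" if "L \<noteq> LT" "Y \<noteq> LT" for L Y
    using that by (cases L; cases Y) (metis orbit)+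
  have "\<exists>L Y. y = [L, LT, Y] \<and> L \<noteq> LT \<and> Y \<noteq> LT" if "y \<in> W [True]" for y
    using that by auto
  then have "F y = F [LA, LT, LA]" if "y \<in> W [True]" for y
    using const that by blast
  from this[OF v] this[OF w] show ?thesis by (rule trans[OF _ sym])
qed

text \<open>The two right extensions differ by a constant. Were it 1, the sums over the three first
  letters would differ as well, against \<open>sum\<close>. So the extensions agree, and rigidity of
  \<open>True # q\<close> makes their common value constant.\<close>

lemma rigid_True_snoc_False_const:
  assumes rig: "rigid (True # q)"
    and inv: "\<And>w s. w \<in> W (True # q @ [False]) \<Longrightarrow> (F (sect s w) :: bool) = F w"
    and sum: "\<And>v w. v \<in> W (q @ [False]) \<Longrightarrow> w \<in> W (q @ [False]) \<Longrightarrow>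
      F (LA # LT # v) \<diamond> (F (LB # LT # v) \<diamond> F (LC # LT # v)) =
      F (LA # LT # w) \<diamond> (F (LB # LT # w) \<diamond> F (LC # LT # w))"
    and v: "v \<in> W (True # q @ [False])" and w: "w \<in> W (True # q @ [False])"
  shows "F v = F w"
proof -
  let ?p = "True # q"
  define P R where "P w = F (w @ [nxt (last w)])" and "R w = F (w @ [prv (last w)])" for w
  have shift: "P (sect t w) = (if t then R w else P w)" "R (sect t w) = (if t then P w else R w)"
    if w: "w \<in> W ?p" for w t
  proof -
    note n = W_nonempty[OF w]
    note sn = sect_snoc_nxt[of w t]
    have 1: "F (sect (t \<diamond> flips (nxt (last w))) (w @ [nxt (last w)])) = P w"
      "F (sect (t \<diamond> flips (prv (last w))) (w @ [prv (last w)])) = R w"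
      using inv snoc_nxt_mem_W[OF w] n unfolding P_def R_def by simp_all
    show "P (sect t w) = (if t then R w else P w)" "R (sect t w) = (if t then P w else R w)"
      using 1 sn n by (auto simp: P_def R_def simp del: W.simps split: if_splits)
  qed
  have M: "(P v \<diamond> R v) = (P w \<diamond> R w)" if "v \<in> W ?p" "w \<in> W ?p" for v w
  proof (rule rigid_invariant[OF rig, of "\<lambda>w. P w \<diamond> R w"])
    show "P (sect s w) \<diamond> R (sect s w) = P w \<diamond> R w" if "w \<in> W ?p" for w s
      using shift[OF that, of s] by (auto simp: xor_def)
  qed (use that in auto)
  obtain u where u: "u \<in> W q" using W_ex by blast
  note n = W_nonempty[OF u]
  have mem: "L # LT # u \<in> W ?p" if "L \<noteq> LT" for L using u that by auto
  have "\<not> (P (LA # LT # u) \<diamond> R (LA # LT # u))"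
    using sum[OF snoc_nxt_mem_W[OF u]] M[OF mem[of LA] mem[of LB]] M[OF mem[of LA] mem[of LC]] n
    by (auto simp: P_def R_def xor_def)
  then have PR: "R w = P w" if "w \<in> W ?p" for w using M[OF that mem[of LA]] by (auto simp: xor_def)
  have P: "P v = P w" if "v \<in> W ?p" "w \<in> W ?p" for v w
    by (rule rigid_invariant[OF rig _ that]) (use shift PR in auto)
  have "\<exists>x. x \<in> W ?p \<and> F y = P x" if y: "y \<in> W (True # q @ [False])" for y
  proof -
    have "y \<in> W (?p @ [False])" using y by simp
    then obtain x L where x: "y = x @ [L]" "x \<in> W ?p" "L \<noteq> LT" "L \<noteq> last x"
      unfolding W_snoc_False by blast
    then have "L = nxt (last x) \<or> L = prv (last x)" using W_nonempty[OF x(2)] letter_nbrs by auto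
    then show ?thesis using x PR[OF x(2)] by (auto simp: P_def R_def)
  qed
  then show ?thesis using P v w by metis
qed

text \<open>A \<open>3 \<times> 3\<close> table with two ones in each row and column is the complement of a permutation matrix.
  \<open>even_zeros\<close> tells whether the permutation is even or odd.\<close>

definition even_zeros :: "(letter \<Rightarrow> letter \<Rightarrow> bool) \<Rightarrow> bool" where
  "even_zeros N \<longleftrightarrow> (\<not> N LA LA \<and> \<not> N LB LB) \<or> (\<not> N LA LB \<and> \<not> N LB LC) \<or> (\<not> N LA LC \<and> \<not> N LB LA)"

text \<open>The rows are permuted by a 3-cycle or a transposition according to
  \<open>t \<diamond> p\<close>, the columns according to \<open>t\<close>. In the product of the
  two signs \<open>t\<close> cancels and \<open>p\<close> remains.\<close>

lemma even_zeros_step: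
  assumes row: "\<And>L. L \<noteq> LT \<Longrightarrow> N L LA = (N L LB \<noteq> N L LC) \<and> (N L LA \<or> N L LB \<or> N L LC)"
    and col: "\<And>Z. Z \<noteq> LT \<Longrightarrow> N LA Z = (N LB Z \<noteq> N LC Z)"
    and step: "\<And>L Z. L \<noteq> LT \<Longrightarrow> Z \<noteq> LT \<Longrightarrow>
      N' (lsec L (\<not> (t \<diamond> p))) (lsec Z (\<not> (t \<diamond> flips Z))) = N L Z"
  shows "even_zeros N' = even_zeros N \<diamond> p"
proof -
  have r: "N L LC \<longleftrightarrow> N L LA \<noteq> N L LB" "N L LA \<or> N L LB" if "L \<noteq> LT" for L
    using row[OF that] by auto
  have c: "N LC Z \<longleftrightarrow> N LA Z \<noteq> N LB Z" if "Z \<noteq> LT" for Z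
    using col[OF that] by auto
  have nz: "N LA LA \<or> N LA LB" "N LB LA \<or> N LB LB" "(N LA LA \<noteq> N LB LA) \<or> (N LA LB \<noteq> N LB LB)"
    using r(2)[of LA] r(2)[of LB] r(2)[of LC] c[of LA] c[of LB] by auto
  note s = step[of LA LA] step[of LA LB] step[of LA LC]
      step[of LB LA] step[of LB LB] step[of LB LC] step[of LC LA] step[of LC LB] step[of LC LC]
  show ?thesis
  proof (cases t; cases p)
    assume tp: "t" "p"
    then have tp': "t = True" "p = True" by auto
    note s' = s[unfolded tp', simplified]
    show ?thesis unfolding even_zeros_def s' using nz tp
      by (simp add: r(1) c) blast
  next
    assume tp: "t" "\<not> p"
    then have tp': "t = True" "p = False" by auto
    note s' = s[unfolded tp', simplified]
    show ?thesis unfolding even_zeros_def s' using nz tp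
      by (simp add: r(1) c) blast
  next
    assume tp: "\<not> t" "p"
    then have tp': "t = False" "p = True" by auto
    note s' = s[unfolded tp', simplified]
    show ?thesis unfolding even_zeros_def s' using nz tp
      by (simp add: r(1) c) blast
  next
    assume tp: "\<not> t" "\<not> p"
    then have tp': "t = False" "p = False" by auto
    note s' = s[unfolded tp', simplified]
    show ?thesis unfolding even_zeros_def s' using nz tp
      by (simp add: r(1) c) blast
  qed
qed

text \<open>For a fixed middle \<open>v\<close> the values on \<open>L # LT # v @ [LT, Z]\<close>
  form a 3 by 3 table. Adding a constant \<open>k\<close> makes all row and column sums vanish; if
  no row is zero, the table is the complement of a permutation matrix, and the sign of the
  permutation would be a cocycle with correction \<open>par v\<close>.\<close>

lemma rigid_True_snoc_True_const:
  assumes rq: "rigid q" and rig: "rigid (True # q)"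
    and inv: "\<And>w s. w \<in> W (True # q @ [True]) \<Longrightarrow> (F (sect s w) :: bool) = F w"
    and sum: "\<And>v w. v \<in> W (q @ [True]) \<Longrightarrow> w \<in> W (q @ [True]) \<Longrightarrow>
      F (LA # LT # v) \<diamond> (F (LB # LT # v) \<diamond> F (LC # LT # v)) =
      F (LA # LT # w) \<diamond> (F (LB # LT # w) \<diamond> F (LC # LT # w))"
    and v: "v \<in> W (True # q @ [True])" and w: "w \<in> W (True # q @ [True])"
  shows "F v = F w"
proof -
  let ?p = "True # q"
  have step: "F (sect t w @ [LT, lsec Z (\<not> (t \<diamond> flips Z))]) = F (w @ [LT, Z])"
    if "w \<in> W ?p" "Z \<noteq> LT" for w t Z
  proof -
    have "w @ [LT, Z] \<in> W (?p @ [True])" using that unfolding W_snoc_True by blast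
    then have "w @ [LT, Z] \<in> W (True # q @ [True])" by simp
    from inv[OF this, of "\<not> (t \<diamond> flips Z)"] show ?thesis unfolding sect_snoc_T .
  qed
  define K where "K w \<longleftrightarrow> F (w @ [LT, LA]) \<diamond> (F (w @ [LT, LB]) \<diamond> F (w @ [LT, LC]))" for w
  have K: "K v = K w" if "v \<in> W ?p" "w \<in> W ?p" for v w
  proof (rule rigid_invariant[OF rig _ that])
    show "K (sect s w) = K w" if "w \<in> W ?p" for w s
      using step[OF that, of LA s] step[OF that, of LB s] step[OF that, of LC s]
      unfolding K_def by (cases s) (auto simp: xor_def)
  qed
  obtain u where u: "u \<in> W q" using W_ex by blast
  define k where "k = K (LA # LT # u)"
  have mem: "L # LT # v \<in> W ?p" if "L \<noteq> LT" "v \<in> W q" for L v using that by auto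
  have mem2: "v @ [LT, Z] \<in> W (q @ [True])" if "Z \<noteq> LT" "v \<in> W q" for v Z
    using that by (auto simp: W_snoc_True)
  define N where "N v L Z \<longleftrightarrow> F (L # LT # v @ [LT, Z]) \<diamond> k" for v L Z
  have row: "\<not> (N v L LA \<diamond> (N v L LB \<diamond> N v L LC))" if "L \<noteq> LT" "v \<in> W q" for v L
    using K[OF mem[OF that] mem[of LA u]] u by (auto simp: N_def k_def K_def xor_def)
  define c where "c = F (LA # LT # u @ [LT, LA]) \<diamond> (F (LB # LT # u @ [LT, LA]) \<diamond> F (LC # LT # u @ [LT, LA]))"
  have col0: "N v LA Z \<diamond> (N v LB Z \<diamond> N v LC Z) \<longleftrightarrow> c \<diamond> k" if "Z \<noteq> LT" "v \<in> W q" for v Z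
    using sum[OF mem2[OF that] mem2[of LA u]] u by (auto simp: N_def c_def xor_def)
  \<comment> \<open>All three column sums equal \<open>c \<diamond> k\<close>, and their total is
    that of the vanishing row sums; three is odd.\<close>
  have "\<not> (c \<diamond> k)"
    using col0[of LA u] col0[of LB u] col0[of LC u] row[of LA u] row[of LB u] row[of LC u] u
    by (auto simp: xor_def)
  then have col: "\<not> (N v LA Z \<diamond> (N v LB Z \<diamond> N v LC Z))" if "Z \<noteq> LT" "v \<in> W q" for v Z
    using col0[OF that] by simp
  \<comment> \<open>\<open>Q\<close> says that a row of the table is zero. It is invariant under
    sections, so it holds for all rows or for none.\<close>
  define Q where "Q w \<longleftrightarrow> F (w @ [LT, LA]) = k \<and> F (w @ [LT, LB]) = k \<and> F (w @ [LT, LC]) = k" for w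
  have Q: "Q v = Q w" if "v \<in> W ?p" "w \<in> W ?p" for v w
  proof (rule rigid_invariant[OF rig _ that])
    show "Q (sect s w) = Q w" if "w \<in> W ?p" for w s
      using step[OF that, of LA s] step[OF that, of LB s] step[OF that, of LC s]
      unfolding Q_def by (cases s) (auto simp: xor_def)
  qed
  have "Q (LA # LT # u)"
  proof (rule ccontr)
    assume "\<not> Q (LA # LT # u)"
    then have nQ: "\<not> Q w" if "w \<in> W ?p" for w using Q[OF that mem[of LA u]] u by simp
    then have nz: "N v L LA \<or> N v L LB \<or> N v L LC" if "L \<noteq> LT" "v \<in> W q" for v L
      using nQ[OF mem[OF that]] by (auto simp: Q_def N_def xor_def)
    have "even_zeros (N (sect t v)) = even_zeros (N v) \<diamond> par v" if v: "v \<in> W q" for v t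
    proof (rule even_zeros_step)
      have sv: "sect t v \<in> W q" using v by (rule sect_W)
      show "N (sect t v) (lsec L (\<not> (t \<diamond> par v))) (lsec Z (\<not> (t \<diamond> flips Z))) = N v L Z"
        if "L \<noteq> LT" "Z \<noteq> LT" for L Z
        using step[OF mem[OF that(1) v] that(2), of t] by (simp add: N_def)
      show "N v L LA = (N v L LB \<noteq> N v L LC) \<and> (N v L LA \<or> N v L LB \<or> N v L LC)"
        if "L \<noteq> LT" for L
        using row[OF that v] nz[OF that v] by (auto simp: xor_def)
      show "N v LA Z = (N v LB Z \<noteq> N v LC Z)" if "Z \<noteq> LT" for Z
        using col[OF that v] by (auto simp: xor_def)
    qed
    then have "cocycle q (\<lambda>v. even_zeros (N v)) False False True" by (simp add: cocycle_def)
    then show False using rigidD(3)[OF rq] by blast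
  qed
  then have "Q w" if "w \<in> W ?p" for w using Q[OF that mem[of LA u]] u by simp
  then have "F y = k" if y: "y \<in> W (True # q @ [True])" for y
  proof -
    have "y \<in> W (?p @ [True])" using y by simp
    then obtain x L where x: "y = x @ [LT, L]" "x \<in> W ?p" "L \<noteq> LT"
      unfolding W_snoc_True by blast
    have "Q x" using \<open>\<And>w. w \<in> W ?p \<Longrightarrow> Q w\<close> x by blast
    then show ?thesis using x by (cases L) (auto simp: Q_def)
  qed
  then show ?thesis using v w by simp
qed

text \<open>In front of \<open>LT\<close> the first letter is free. Summing over it keeps all three
  coefficients: there are three summands, and the four extra flips, one from \<open>LC\<close> and
  three from \<open>LT\<close>, cancel. So rigidity of \<open>q\<close> kills the coefficients and
  makes the sums constant.\<close>

lemma rigid_TrueI: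
  assumes rig: "\<And>p. length p \<le> length q \<Longrightarrow> rigid p"
  shows "rigid (True # q)"
  unfolding rigid_def
proof (intro allI impI)
  fix F a b c assume co: "cocycle (True # q) F a b c"
  define S where "S w = F (LA # LT # w) \<diamond> (F (LB # LT # w) \<diamond> F (LC # LT # w))" for w
  have "S (sect s w) = S w \<diamond> (a \<diamond> ((b \<and> s) \<diamond> (c \<and> par w)))" if w: "w \<in> W q" for w s
  proof -
    have "F (lsec L (\<not> (s \<diamond> par w)) # LT # sect s w)
        = F (L # LT # w) \<diamond> (a \<diamond> ((b \<and> s) \<diamond> (c \<and> \<not> (flips L \<diamond> par w))))" if "L \<noteq> LT" for L
      using cocycleD[OF co, of "L # LT # w" s] w that by simp
    from this[of LA] this[of LB] this[of LC] show ?thesis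
      unfolding S_def by (cases s; cases "par w"; auto simp: xor_def)
  qed
  then have S: "cocycle q S a b c" by (simp add: cocycle_def)
  have rq: "rigid q" using rig by simp
  note abc = rigidD(1-3)[OF rq S]
  have inv: "F (sect s w) = F w" if "w \<in> W (True # q)" for w s
    using cocycleD[OF co that] abc by simp
  have sum: "S v = S w" if "v \<in> W q" "w \<in> W q" for v w
    by (rule rigidD(4)[OF rq S that])
  have "F v = F w" if vw: "v \<in> W (True # q)" "w \<in> W (True # q)" for v w
  proof (cases q rule: rev_cases)
    case Nil
    then show ?thesis using rigid_True_Nil_const[of F v w] inv vw by simp
  next
    case (snoc r x)
    have r: "rigid r" "rigid (True # r)" using rig snoc by simp_all
    show ?thesis
    proof (cases x)
      case True
      then have q: "q = r @ [True]" using snoc by simp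
      show ?thesis
        by (rule rigid_True_snoc_True_const[OF r inv[unfolded q] sum[unfolded S_def q] vw[unfolded q]])
    next
      case False
      then have q: "q = r @ [False]" using snoc by simp
      show ?thesis
        by (rule rigid_True_snoc_False_const[OF r(2) inv[unfolded q] sum[unfolded S_def q] vw[unfolded q]])
    qed
  qed
  then show "\<not> a \<and> \<not> b \<and> \<not> c \<and> (\<forall>v\<in>W (True # q). \<forall>w\<in>W (True # q). F v = F w)"
    using abc by blast
qed

theorem rigid: "rigid p"
proof (induction "length p" arbitrary: p rule: less_induct)
  case less
  show ?case
  proof (cases p)
    case Nil
    then show ?thesis using rigid_Nil by simp
  next
    case (Cons x q)
    show ?thesis
    proof (cases x)
      case True
      then show ?thesis using rigid_TrueI[of q] less Cons by simp
    next
      case False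
      \<comment> \<open>Head cocycles have to be excluded only for \<open>q\<close> empty or
        beginning with \<open>True\<close>, and this uses rigidity of patterns shorter than
        \<open>q\<close>.\<close>
      have "(\<exists>q'. q = False # q') \<or> (\<forall>G. \<not> hd_cocycle q G)"
        using not_hd_cocycleI[of q] less Cons by (cases q) auto
      then show ?thesis using rigid_FalseI[of q] less Cons False by simp
    qed
  qed
qed

lemma reduced_append:
  "reduced (v @ w) \<longleftrightarrow> reduced v \<and> reduced w \<and> (v = [] \<or> w = [] \<or> hd w \<noteq> inv_letter (last v))"
proof (induction v)
  case (Cons x v)
  then show ?case by (cases v; cases w) (auto simp: reduced_Cons)
qed simp

section \<open>Words in the states of an automaton\<close>

definition letter_act :: "automaton \<Rightarrow> state signed \<Rightarrow> bool list \<Rightarrow> bool list" where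
  "letter_act A x = act (if fst x then A else inverse_automaton A) (snd x)"

fun word_act :: "automaton \<Rightarrow> state signed list \<Rightarrow> bool list \<Rightarrow> bool list" where
  "word_act A [] = id"
| "word_act A (x # w) = letter_act A x \<circ> word_act A w"

lemma word_act_append: "word_act A (v @ w) = word_act A v \<circ> word_act A w"
  by (induction v) (auto simp: comp_assoc)

lemma letter_act_inv: "letter_act A x \<circ> letter_act A (inv_letter x) = id"
  using act_inverse[of A] act_inverse[of "inverse_automaton A"]
  by (auto simp: letter_act_def inv_letter_def inverse_automaton_involution fun_eq_iff)

lemma letter_act_inv': "letter_act A (inv_letter x) \<circ> letter_act A x = id"
  using letter_act_inv[of A "inv_letter x"] by simp

lemma word_act_prepend: "word_act A (prepend x w) = letter_act A x \<circ> word_act A w"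
proof (cases w)
  case (Cons y v)
  then show ?thesis using letter_act_inv[of A x] by (auto simp: comp_assoc[symmetric])
qed simp

lemma word_act_foldr_prepend: "word_act A (foldr prepend v w) = word_act A v \<circ> word_act A w"
  by (induction v) (auto simp: word_act_prepend comp_assoc)

lemma letter_act_in_tree_aut: "letter_act A x \<in> carrier tree_aut"
  by (simp add: letter_act_def act_in_tree_aut)

text \<open>Inverses of generators are actions of the inverse automaton, so words in signed states
  already exhaust the generated subgroup.\<close>

lemma carrier_automaton_group: "carrier (automaton_group A) = range (word_act A)"
proof -
  interpret group tree_aut by (rule group_tree_aut)
  let ?S = "carrier tree_aut \<inter> range (act A)"
  have S: "?S = range (act A)" using act_in_tree_aut by auto
  have mult: "f \<otimes>\<^bsub>tree_aut\<^esub> g = f \<circ> g" for f g by (simp add: tree_aut_def)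
  have inv_eq: "inv\<^bsub>tree_aut\<^esub> (act A q) = letter_act A (False, q)" for q
    using letter_act_in_tree_aut[of A "(False, q)"] act_in_tree_aut[of A q]
      letter_act_inv[of A "(False, q)"]
    by (intro inv_equality) (auto simp: tree_aut_def letter_act_def inv_letter_def)
  have "generate tree_aut ?S = range (word_act A)"
  proof (intro equalityI subsetI)
    fix f assume "f \<in> generate tree_aut ?S"
    then show "f \<in> range (word_act A)"
    proof induction
      case one
      have "word_act A [] = \<one>\<^bsub>tree_aut\<^esub>" by (simp add: tree_aut_def)
      then show ?case by (metis rangeI)
    next
      case (incl h)
      then obtain q where "h = word_act A [(True, q)]" by (auto simp: letter_act_def)
      then show ?case by (metis rangeI)
    next
      case (inv h)
      then obtain q where "h = act A q" by auto
      then have "inv\<^bsub>tree_aut\<^esub> h = word_act A [(False, q)]" by (simp add: inv_eq)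
      then show ?case by (metis rangeI)
    next
      case (eng f g)
      then obtain v w where "f = word_act A v" "g = word_act A w" by blast
      then have "f \<otimes>\<^bsub>tree_aut\<^esub> g = word_act A (v @ w)" by (simp only: mult word_act_append)
      then show ?case by (metis rangeI)
    qed
  next
    fix f assume "f \<in> range (word_act A)"
    then obtain w where w: "f = word_act A w" by blast
    have l: "letter_act A x \<in> generate tree_aut ?S" for x
    proof (cases "fst x")
      case True
      then show ?thesis unfolding S by (auto simp: letter_act_def intro: generate.incl)
    next
      case False
      then have "x = (False, snd x)" by (cases x) auto
      then have "letter_act A x = inv\<^bsub>tree_aut\<^esub> (act A (snd x))" using inv_eq by metis
      then show ?thesis unfolding S by (auto intro: generate.inv)
    qed
    have "word_act A w \<in> generate tree_aut ?S"
    proof (induction w)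
      case Nil
      have "\<one>\<^bsub>tree_aut\<^esub> = word_act A []" by (simp add: tree_aut_def)
      then show ?case by (metis generate.one)
    next
      case (Cons x w)
      then show ?case using generate.eng[OF l Cons, unfolded mult] by (simp only: word_act.simps)
    qed
    then show "f \<in> generate tree_aut ?S" using w by simp
  qed
  then show ?thesis by (simp add: automaton_group_def subgroup_generated_def)
qed

lemma mult_automaton_group [simp]: "f \<otimes>\<^bsub>automaton_group A\<^esub> g = f \<circ> g"
  by (simp add: automaton_group_def subgroup_generated_def tree_aut_def)

lemma one_automaton_group [simp]: "\<one>\<^bsub>automaton_group A\<^esub> = id"
  by (simp add: automaton_group_def subgroup_generated_def tree_aut_def)

lemma group_automaton_group: "group (automaton_group A)"
  unfolding automaton_group_def by (rule group.group_subgroup_generated[OF group_tree_aut])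

lemma pow_automaton_group: "f [^]\<^bsub>automaton_group A\<^esub> (n::nat) = f ^^ n"
  by (induction n) (auto simp: nat_pow_def funpow_swap1)

text \<open>\<open>out A w s\<close> is the image of the letter \<open>s\<close>, and \<open>section_word A w s\<close> a word for the section of
  \<open>w\<close> at \<open>s\<close>.\<close>

fun out :: "automaton \<Rightarrow> state signed list \<Rightarrow> bool \<Rightarrow> bool" where
  "out A [] s = s"
| "out A (x # w) s = (fst (A (snd x)) \<noteq> out A w s)"

text \<open>For an active state the inverse is \<open>\<sigma>\<close> times the exchanged inverse
  sections, hence the test \<open>s = (i \<and> \<not> e)\<close>: at \<open>True\<close>, the
  inverse of an active state continues with the inverse of \<open>q0\<close>.\<close>

fun letter_section :: "automaton \<Rightarrow> state signed \<Rightarrow> bool \<Rightarrow> state signed" where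
  "letter_section A (e, q) s =
    (e, case A q of (i, q0, q1) \<Rightarrow> if s = (i \<and> \<not> e) then q0 else q1)"

fun section_word :: "automaton \<Rightarrow> state signed list \<Rightarrow> bool \<Rightarrow> state signed list" where
  "section_word A [] s = []"
| "section_word A (x # w) s = prepend (letter_section A x (out A w s)) (section_word A w s)"

lemma word_act_Nil [simp]: "word_act A w [] = []"
  by (induction w) (auto simp: letter_act_def)

lemma letter_act_Cons:
  "letter_act A x (s # v) = (fst (A (snd x)) \<noteq> s) # letter_act A (letter_section A x s) v"
  by (cases x) (auto simp: letter_act_def inverse_automaton_def split: prod.splits)

lemma word_act_Cons: "word_act A w (s # v) = out A w s # word_act A (section_word A w s) v"
  by (induction w) (auto simp: letter_act_Cons word_act_prepend)

lemma word_act_eq_id_iff: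
  "word_act A w = id \<longleftrightarrow> (\<forall>s. out A w s = s \<and> word_act A (section_word A w s) = id)"
proof
  assume "word_act A w = id"
  then have "out A w s # word_act A (section_word A w s) v = s # v" for s v
    using word_act_Cons[of A w s v] by simp
  then show "\<forall>s. out A w s = s \<and> word_act A (section_word A w s) = id" by (auto simp: fun_eq_iff)
next
  assume *: "\<forall>s. out A w s = s \<and> word_act A (section_word A w s) = id"
  show "word_act A w = id"
  proof
    fix v show "word_act A w v = id v" using * by (cases v) (auto simp: word_act_Cons)
  qed
qed

section \<open>Freeness of the Aleshin--Vorobets group\<close>

fun letter_map :: "letter \<Rightarrow> bool list \<Rightarrow> bool list" where
  "letter_map L [] = []"
| "letter_map L (s # v) = (s \<diamond> flips L) # letter_map (lsec L s) v"

fun letters_map :: "letter list \<Rightarrow> bool list \<Rightarrow> bool list" where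
  "letters_map [] = id"
| "letters_map (L # w) = letter_map L \<circ> letters_map w"

lemma letters_map_Cons: "letters_map w (s # v) = (s \<diamond> par w) # letters_map (sect s w) v"
  by (induction w) (auto simp: xor_ac)

lemma letters_map_Nil [simp]: "letters_map w [] = []"
  by (induction w) auto

lemma letters_map_eq_id_iff:
  "letters_map w = id \<longleftrightarrow> \<not> par w \<and> (\<forall>s. letters_map (sect s w) = id)"
proof
  assume "letters_map w = id"
  then have "(s \<diamond> par w) # letters_map (sect s w) v = s # v" for s v
    using letters_map_Cons[of w s v] by simp
  then show "\<not> par w \<and> (\<forall>s. letters_map (sect s w) = id)" by (auto simp: fun_eq_iff xor_def)
next
  assume *: "\<not> par w \<and> (\<forall>s. letters_map (sect s w) = id)"
  show "letters_map w = id"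
  proof
    fix v show "letters_map w v = id v" using * by (cases v) (auto simp: letters_map_Cons)
  qed
qed

text \<open>Triviality passes to sections, and back because an injective section map permutes the
  finite set of trivial words in \<open>W p\<close>. By rigidity all words in \<open>W p\<close>
  would be trivial, hence of even activity, and a constant function would be a cocycle with
  \<open>c\<close> equal to 1.\<close>

theorem letters_map_neq_id:
  assumes "w \<in> W p"
  shows "letters_map w \<noteq> id"
proof
  assume triv: "letters_map w = id"
  define F where "F v \<longleftrightarrow> letters_map v = id" for v
  define Z where "Z = {v \<in> W p. F v}"
  have fin: "finite Z" using finite_W[of p] by (simp add: Z_def)
  have inv: "F (sect s v) = F v" if v: "v \<in> W p" for v s
  proof
    assume "F v"
    then show "F (sect s v)" unfolding F_def using letters_map_eq_id_iff by blast
  next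
    assume "F (sect s v)"
    have "sect s ` Z \<subseteq> Z"
      using sect_W unfolding Z_def F_def using letters_map_eq_id_iff by blast
    moreover have "inj_on (sect s) Z" by (rule inj_onI) (rule sect_inj)
    ultimately have "sect s ` Z = Z" using fin by (rule endo_inj_surj[rotated])
    moreover have "sect s v \<in> Z" using sect_W[OF v] \<open>F (sect s v)\<close> by (simp add: Z_def)
    ultimately obtain u where "u \<in> Z" "sect s v = sect s u" by blast
    then show "F v" using sect_inj[of s v u] by (simp add: Z_def)
  qed
  have "F v = F w" if "v \<in> W p" for v
    by (rule rigid_invariant[OF rigid inv that assms])
  then have "\<not> par v" if "v \<in> W p" for v
    using that triv letters_map_eq_id_iff[of v] by (simp add: F_def)
  then have "cocycle p (\<lambda>_. True) False False True" by (simp add: cocycle_def)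
  then show False using rigidD(3)[OF rigid] by blast
qed

fun state_letter :: "state \<Rightarrow> letter" where
  "state_letter Sa = LA" | "state_letter Sb = LB" | "state_letter Sc = LC"

lemma state_letter_simps [simp]: "state_letter q \<noteq> LT" "state_letter q = state_letter r \<longleftrightarrow> q = r"
  by (cases q; cases r; simp)+

lemma letter_map_involution: "letter_map L (letter_map L v) = v"
proof (induction v arbitrary: L)
  case (Cons s v)
  show ?case by (cases L; cases s) (simp_all add: Cons)
qed simp

lemma flip_letter_map: "letter_map LT (letter_map (state_letter q) v) = act aleshin_vorobets q v"
proof (induction v arbitrary: q)
  case (Cons s v)
  show ?case using Cons[of Sa] Cons[of Sb] Cons[of Sc] by (cases q; cases s) auto
qed simp

lemma letter_act_aleshin_vorobets:
  "letter_act aleshin_vorobets (True, q) = letter_map LT \<circ> letter_map (state_letter q)"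
  "letter_act aleshin_vorobets (False, q) = letter_map (state_letter q) \<circ> letter_map LT"
proof -
  show *: "letter_act aleshin_vorobets (True, q) = letter_map LT \<circ> letter_map (state_letter q)"
    by (simp add: letter_act_def fun_eq_iff flip_letter_map)
  have "letter_act aleshin_vorobets (False, q) =
      letter_act aleshin_vorobets (False, q) \<circ> (letter_act aleshin_vorobets (True, q) \<circ>
        (letter_map (state_letter q) \<circ> letter_map LT))"
    unfolding * by (simp add: fun_eq_iff letter_map_involution)
  also have "\<dots> = letter_map (state_letter q) \<circ> letter_map LT"
    using letter_act_inv'[of aleshin_vorobets "(True, q)"] by (simp add: comp_assoc[symmetric] inv_letter_def)
  finally show "letter_act aleshin_vorobets (False, q) = letter_map (state_letter q) \<circ> letter_map LT" .
qed

text \<open>Between neighbouring generators \<open>\<tau>\<close> cancels exactly if their exponents differ, and then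
  reducedness makes the adjacent involutions distinct.\<close>

lemma word_act_aleshin_vorobets_normal_form:
  assumes "reduced w" "w \<noteq> []" "fst (last w)"
  shows "\<exists>p. \<exists>v\<in>W p. hd v = state_letter (snd (hd w)) \<and>
    word_act aleshin_vorobets w = letters_map (if fst (hd w) then LT # v else v)"
  using assms
proof (induction w)
  case (Cons x w)
  obtain e q where x: "x = (e, q)" by (cases x)
  show ?case
  proof (cases w)
    case Nil
    have "[state_letter q] \<in> W []" by (cases q) auto
    moreover have "word_act aleshin_vorobets (x # w) = letters_map (LT # [state_letter q])"
      using Nil x Cons(4) by (simp add: letter_act_aleshin_vorobets)
    ultimately show ?thesis using x Nil Cons(4)
      by (intro exI[of _ "[]"] bexI[of _ "[state_letter q]"]) auto
  next
    case (Cons y u)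
    then have red: "reduced w" "y \<noteq> inv_letter x" using \<open>reduced (x # w)\<close> by (auto simp: reduced_Cons)
    have "\<exists>p. \<exists>v\<in>W p. hd v = state_letter (snd y) \<and>
        word_act aleshin_vorobets w = letters_map (if fst y then LT # v else v)"
      using Cons.IH[OF red(1)] Cons.prems unfolding Cons by (simp only: list.sel list.simps last.simps if_False)
    then obtain p v where v: "v \<in> W p" "hd v = state_letter (snd y)"
      "word_act aleshin_vorobets w = letters_map (if fst y then LT # v else v)"
      by blast
    have tt: "letter_map LT \<circ> (letter_map LT \<circ> f) = f" for f :: "bool list \<Rightarrow> bool list"
      by (simp add: fun_eq_iff letter_map_involution)
    consider (same) "e = fst y" | (differ) "e \<noteq> fst y" by blast
    then show ?thesis
    proof cases
      case same
      have "state_letter q # LT # v \<in> W (True # p)" using v(1) by auto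
      moreover have "word_act aleshin_vorobets (x # w) =
         letters_map (if e then LT # state_letter q # LT # v else state_letter q # LT # v)"
        using v(3) same x by (auto simp: letter_act_aleshin_vorobets comp_assoc)
      ultimately show ?thesis using x by (intro exI[of _ "True # p"] bexI[of _ "state_letter q # LT # v"]) auto
    next
      case differ
      then have "q \<noteq> snd y" using red(2) x by (cases y) (auto simp: inv_letter_def)
      then have "state_letter q # v \<in> W (False # p)" using v by auto
      moreover have "word_act aleshin_vorobets (x # w) =
         letters_map (if e then LT # state_letter q # v else state_letter q # v)"
        using v(3) differ x by (auto simp: letter_act_aleshin_vorobets comp_assoc tt)
      ultimately show ?thesis using x by (intro exI[of _ "False # p"] bexI[of _ "state_letter q # v"]) auto
    qed
  qed
qed simp

theorem word_act_aleshin_vorobets_neq_id: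
  assumes "reduced w" "w \<noteq> []"
  shows "word_act aleshin_vorobets w \<noteq> id"
proof
  assume triv: "word_act aleshin_vorobets w = id"
  \<comment> \<open>Conjugation by a state different from both end states keeps the word reduced.
    The new word starts with an inverse and ends with a generator, so its normal form neither starts
    nor ends with \<tau>.\<close>
  have "\<exists>g. g \<noteq> r \<and> g \<noteq> q" for r q :: state by (cases r; cases q; blast)
  then obtain g where g: "g \<noteq> snd (hd w)" "g \<noteq> snd (last w)" by blast
  let ?w = "(False, g) # w @ [(True, g)]"
  have "reduced (w @ [(True, g)])"
    using assms g by (auto simp: reduced_append reduced_Cons inv_letter_def)
  then have "reduced ?w"
    using assms g unfolding reduced_Cons[of "(False, g)"] by (cases w) (auto simp: inv_letter_def)
  then obtain p v where "v \<in> W p" "word_act aleshin_vorobets ?w = letters_map v"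
    using word_act_aleshin_vorobets_normal_form[of ?w] by auto
  moreover have "word_act aleshin_vorobets ?w = id"
    using triv letter_act_inv[of aleshin_vorobets "(False, g)"]
    by (simp add: word_act_append inv_letter_def)
  ultimately show False using letters_map_neq_id by metis
qed

section \<open>Powers and commuting elements in free groups\<close>

lemma (in group) pow_conj:
  assumes "c \<in> carrier G" "x \<in> carrier G"
  shows "(c \<otimes> x \<otimes> inv c) [^] (n::nat) = c \<otimes> x [^] n \<otimes> inv c"
proof (induction n)
  case (Suc n)
  have "inv c \<otimes> (c \<otimes> y) = y" if "y \<in> carrier G" for y
    using assms that by (simp add: m_assoc[symmetric])
  then show ?case using Suc assms by (simp add: m_assoc)
qed (use assms in simp)

lemma foldr_prepend_append_reduced: "reduced (v @ w) \<Longrightarrow> foldr prepend v w = v @ w"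
  using foldr_prepend_reduced[of "v @ w"] foldr_prepend_reduced[of w]
  by (simp add: reduced_append)

lemma inv_letter_neq [simp]: "inv_letter x \<noteq> x" "x \<noteq> inv_letter x"
  by (cases x; simp add: inv_letter_def)+

lemma inv_letter_eq_iff [simp]: "inv_letter x = inv_letter y \<longleftrightarrow> x = y"
  by (metis inv_letter_inv_letter)

lemma length_prepend: "length (prepend x w) \<le> Suc (length w)"
  by (cases w) auto

lemma length_foldr_prepend: "length (foldr prepend v w) \<le> length v + length w"
proof (induction v)
  case (Cons x v)
  then show ?case using length_prepend[of x "foldr prepend v w"] by simp
qed simp

lemma free_group_simps [simp]:
  "carrier (free_group S) = {w. reduced w \<and> snd ` set w \<subseteq> S}"
  "v \<otimes>\<^bsub>free_group S\<^esub> w = foldr prepend v w"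
  "\<one>\<^bsub>free_group S\<^esub> = []"
  by (simp_all add: free_group_def)

lemma inv_free_group_single:
  assumes "snd c \<in> S"
  shows "inv\<^bsub>free_group S\<^esub> [c] = [inv_letter c]"
proof -
  interpret group "free_group S" by (rule group_free_group)
  have "reduced [c]" for c :: "'a signed" by (simp add: reduced_Cons)
  then show ?thesis using assms by (intro inv_equality) (auto simp: inv_letter_def)
qed

text \<open>The list \<open>w\<close> may be unreduced, so the power is taken of its
  reduction.\<close>

lemma foldr_prepend_replicate:
  "foldr prepend (concat (replicate n w)) [] = (foldr prepend w [] [^]\<^bsub>free_group S\<^esub> n)"
proof (induction n)
  case (Suc n)
  let ?v = "foldr prepend w []" and ?u = "concat (replicate n w)"
  have "concat (replicate (Suc n) w) = ?u @ w"
    by (metis append_Nil2 concat.simps concat_append replicate_Suc replicate_append_same)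
  then have "foldr prepend (concat (replicate (Suc n) w)) [] = foldr prepend ?u ?v" by simp
  also have "\<dots> = foldr prepend (foldr prepend ?u []) ?v"
    using foldr_prepend_assoc[of ?v ?u "[]"] by (simp add: reduced_foldr_prepend)
  finally show ?case using Suc by (simp add: nat_pow_def)
qed (simp add: nat_pow_def)

text \<open>Powers of a cyclically reduced word are plain concatenations. Any other word is
  conjugate by a letter to a shorter one, and this conjugation changes lengths by at most 2, which
  \<open>K\<close> absorbs.\<close>

lemma free_group_power_length:
  assumes "x \<in> carrier (free_group S)" "x \<noteq> []"
  shows "\<exists>K. \<forall>n::nat. n \<le> length (x [^]\<^bsub>free_group S\<^esub> n) + K"
  using assms
proof (induction "length x" arbitrary: x rule: less_induct)
  case less
  interpret group "free_group S" by (rule group_free_group)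
  have x: "reduced x" "snd ` set x \<subseteq> S" using less.prems by simp_all
  show ?case
  proof (cases "hd x = inv_letter (last x)")
    case False
    have "reduced (concat (replicate n x)) \<and> (n > 0 \<longrightarrow> hd (concat (replicate n x)) = hd x)" for n
    proof (induction n)
      case (Suc n)
      then show ?case using False x less.prems(2) by (cases n) (auto simp: reduced_append)
    qed simp
    then have "x [^]\<^bsub>free_group S\<^esub> n = concat (replicate n x)" for n :: nat
      using foldr_prepend_replicate[of n x S] foldr_prepend_reduced x(1) by metis
    moreover have "length (concat (replicate n x)) = n * length x" for n
      by (induction n) auto
    moreover have "length x \<ge> 1" using less.prems by (cases x) auto
    ultimately have "n \<le> length (x [^]\<^bsub>free_group S\<^esub> n) + 0" for n :: nat by simp
    then show ?thesis by blast
  next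
    case True
    define c where "c = hd x"
    obtain z where z: "x = c # z" using less.prems c_def by (cases x) auto
    have inv: "inv_letter (last x) = c" using True c_def by simp
    then have "last x = inv_letter c" by auto
    moreover have "z \<noteq> []" using inv z by auto
    ultimately obtain y where y: "x = c # y @ [inv_letter c]"
      using z by (cases z rule: rev_cases) auto
    have yne: "y \<noteq> []" using x(1) unfolding y by (auto simp: reduced_Cons)
    have ymem: "y \<in> carrier (free_group S)" using x unfolding y by (auto simp: reduced_Cons reduced_append)
    have c: "snd c \<in> S" "[c] \<in> carrier (free_group S)" using x(2) y by (auto simp: reduced_Cons)
    have ci: "[inv_letter c] \<in> carrier (free_group S)" using c by (auto simp: reduced_Cons inv_letter_def)
    have "x = foldr prepend ([c] @ y @ [inv_letter c]) []"
      using foldr_prepend_reduced[OF x(1)] y by simp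
    also have "\<dots> = [c] \<otimes>\<^bsub>free_group S\<^esub> (y \<otimes>\<^bsub>free_group S\<^esub> [inv_letter c])" by simp
    finally have "x = [c] \<otimes>\<^bsub>free_group S\<^esub> y \<otimes>\<^bsub>free_group S\<^esub> [inv_letter c]"
      using m_assoc[OF c(2) ymem ci] by (simp del: free_group_simps)
    then have xn: "x [^]\<^bsub>free_group S\<^esub> n = [c] \<otimes>\<^bsub>free_group S\<^esub> y [^]\<^bsub>free_group S\<^esub> n \<otimes>\<^bsub>free_group S\<^esub> [inv_letter c]" for n :: nat
      using pow_conj[OF c(2) ymem, of n] inv_free_group_single[OF c(1)] by (simp del: free_group_simps)
    have yx: "length (y [^]\<^bsub>free_group S\<^esub> n) \<le> length (x [^]\<^bsub>free_group S\<^esub> n) + 2" for n :: nat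
    proof -
      let ?y = "y [^]\<^bsub>free_group S\<^esub> n"
      have ym: "?y \<in> carrier (free_group S)" using ymem nat_pow_closed by blast
      have 1: "inv\<^bsub>free_group S\<^esub> [c] \<otimes>\<^bsub>free_group S\<^esub> ([c] \<otimes>\<^bsub>free_group S\<^esub> ?y \<otimes>\<^bsub>free_group S\<^esub> inv\<^bsub>free_group S\<^esub> [c] \<otimes>\<^bsub>free_group S\<^esub> [c]) = ?y"
        using c(2) ym by (simp add: m_assoc[symmetric] del: free_group_simps) (simp add: m_assoc del: free_group_simps)
      have "?y = [inv_letter c] \<otimes>\<^bsub>free_group S\<^esub> (x [^]\<^bsub>free_group S\<^esub> n \<otimes>\<^bsub>free_group S\<^esub> [c])"
        unfolding xn using 1 inv_free_group_single[OF c(1)] by (simp del: free_group_simps)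
      then have "length ?y \<le> 1 + length (foldr prepend (x [^]\<^bsub>free_group S\<^esub> n) [c])"
        using length_foldr_prepend[of "[inv_letter c]"] by (metis free_group_simps(2) length_Cons list.size(3) One_nat_def)
      also have "\<dots> \<le> 1 + (length (x [^]\<^bsub>free_group S\<^esub> n) + 1)"
        using length_foldr_prepend[of _ "[c]"] by simp
      finally show ?thesis by simp
    qed
    have "length y < length x" using y by simp
    then obtain K where K: "\<forall>n::nat. n \<le> length (y [^]\<^bsub>free_group S\<^esub> n) + K"
      using less.hyps[OF _ ymem yne] by blast
    have "n \<le> length (x [^]\<^bsub>free_group S\<^esub> n) + (K + 2)" for n :: nat
      using yx[of n] K[rule_format, of n] by linarith
    then show ?thesis by blast
  qed
qed

lemma free_group_torsion_free:
  assumes x: "x \<in> carrier (free_group S)" and n: "(n::nat) > 0" and pow: "x [^]\<^bsub>free_group S\<^esub> n = []"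
  shows "x = []"
proof (rule ccontr)
  interpret group "free_group S" by (rule group_free_group)
  assume "x \<noteq> []"
  then obtain K where K: "\<forall>n::nat. n \<le> length (x [^]\<^bsub>free_group S\<^esub> n) + K"
    using free_group_power_length x by blast
  \<comment> \<open>The exponent \<open>n * Suc K\<close> is a multiple of \<open>n\<close>
    exceeding \<open>K\<close>, so the growth bound fails for this empty power.\<close>
  have "x [^]\<^bsub>free_group S\<^esub> (n * Suc K) = (x [^]\<^bsub>free_group S\<^esub> n) [^]\<^bsub>free_group S\<^esub> (Suc K)"
    by (rule nat_pow_pow[symmetric, OF x])
  also have "\<dots> = []" using nat_pow_one[of "Suc K"] pow by (metis free_group_simps(3))
  finally have "n * Suc K \<le> K" using K by (metis add_0 list.size(3))
  then show False using n by (cases n) auto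
qed

lemma not_exponential_le_linear: "\<exists>n::nat. \<not> 2 ^ n \<le> n * c + d"
proof -
  \<comment> \<open>The witness is the exponent \<open>2 * (c + d + 2) + 1\<close>; squaring
    \<open>m < 2 ^ m\<close> for \<open>m = c + d + 2\<close> gives a quadratic lower bound.\<close>
  have "2 * (c + d + 2) ^ 2 < 2 ^ (2 * (c + d + 2) + 1)" for c d :: nat
  proof -
    have "(c + d + 2) < 2 ^ (c + d + 2)" by (rule less_exp)
    then have "(c + d + 2) ^ 2 < (2 ^ (c + d + 2)) ^ 2" by (rule power_strict_mono) auto
    then show ?thesis by (simp add: power_mult[symmetric] mult.commute)
  qed
  moreover have "(2 * (c + d + 2) + 1) * c + d \<le> 2 * (c + d + 2) ^ 2"
    by (simp add: power2_eq_square algebra_simps)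
  ultimately show ?thesis by (metis not_le order.strict_trans1)
qed

text \<open>Conjugating \<open>x\<close> by the n-th power of \<open>g\<close> gives the power of
  \<open>x\<close> with exponent \<open>k ^ n\<close>. Its length is at most linear in n, whereas
  powers of a nontrivial \<open>x\<close> have length growing at least linearly in the
  exponent.\<close>

lemma free_group_no_expansion:
  assumes x: "x \<in> carrier (free_group S)" and g: "g \<in> carrier (free_group S)" and k: "(k::nat) \<ge> 2"
    and rel: "x \<otimes>\<^bsub>free_group S\<^esub> g = g \<otimes>\<^bsub>free_group S\<^esub> x [^]\<^bsub>free_group S\<^esub> k"
  shows "x = []"
proof (rule ccontr)
  interpret group "free_group S" by (rule group_free_group)
  note [simp del] = free_group_simps
  let ?G = "free_group S"
  assume "x \<noteq> []"
  then obtain K where K: "\<And>n::nat. n \<le> length (x [^]\<^bsub>?G\<^esub> n) + K"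
    using free_group_power_length x by blast
  have step: "g \<otimes>\<^bsub>?G\<^esub> x [^]\<^bsub>?G\<^esub> (k * j) = x [^]\<^bsub>?G\<^esub> j \<otimes>\<^bsub>?G\<^esub> g" for j :: nat
  proof (induction j)
    case (Suc j)
    have "g \<otimes>\<^bsub>?G\<^esub> x [^]\<^bsub>?G\<^esub> (k * Suc j) = g \<otimes>\<^bsub>?G\<^esub> x [^]\<^bsub>?G\<^esub> (k * j) \<otimes>\<^bsub>?G\<^esub> x [^]\<^bsub>?G\<^esub> k"
      using x g by (simp add: m_assoc nat_pow_mult add.commute)
    also have "\<dots> = x [^]\<^bsub>?G\<^esub> j \<otimes>\<^bsub>?G\<^esub> (g \<otimes>\<^bsub>?G\<^esub> x [^]\<^bsub>?G\<^esub> k)"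
      unfolding Suc using x g by (simp add: m_assoc)
    also have "\<dots> = x [^]\<^bsub>?G\<^esub> Suc j \<otimes>\<^bsub>?G\<^esub> g"
      unfolding rel[symmetric] using x g by (simp add: m_assoc)
    finally show ?case .
  qed (use g in simp)
  have iter: "g [^]\<^bsub>?G\<^esub> n \<otimes>\<^bsub>?G\<^esub> x [^]\<^bsub>?G\<^esub> (k ^ n) = x \<otimes>\<^bsub>?G\<^esub> g [^]\<^bsub>?G\<^esub> n" for n :: nat
  proof (induction n)
    case (Suc n)
    have "g [^]\<^bsub>?G\<^esub> Suc n \<otimes>\<^bsub>?G\<^esub> x [^]\<^bsub>?G\<^esub> (k ^ Suc n) = g [^]\<^bsub>?G\<^esub> n \<otimes>\<^bsub>?G\<^esub> (g \<otimes>\<^bsub>?G\<^esub> x [^]\<^bsub>?G\<^esub> (k * k ^ n))"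
      using x g by (simp add: m_assoc)
    also have "\<dots> = g [^]\<^bsub>?G\<^esub> n \<otimes>\<^bsub>?G\<^esub> x [^]\<^bsub>?G\<^esub> (k ^ n) \<otimes>\<^bsub>?G\<^esub> g"
      unfolding step using x g by (simp add: m_assoc)
    also have "\<dots> = x \<otimes>\<^bsub>?G\<^esub> g [^]\<^bsub>?G\<^esub> Suc n"
      unfolding Suc using x g by (simp add: m_assoc)
    finally show ?case .
  qed (use x in simp)
  have len: "length (u \<otimes>\<^bsub>?G\<^esub> v) \<le> length u + length v" for u v
    using length_foldr_prepend[of u v] by (simp add: free_group_simps)
  have lenp: "length (u [^]\<^bsub>?G\<^esub> n) \<le> n * length u" for u and n :: nat
  proof (induction n)
    case 0
    then show ?case by (simp add: free_group_simps)
  next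
    case (Suc n)
    have "length (u [^]\<^bsub>?G\<^esub> Suc n) \<le> length (u [^]\<^bsub>?G\<^esub> n) + length u"
      using len[of "u [^]\<^bsub>?G\<^esub> n" u] by simp
    then show ?case using Suc by simp
  qed
  let ?h = "inv\<^bsub>?G\<^esub> g"
  have "2 ^ n \<le> n * (length ?h + length g) + (length x + K)" for n :: nat
  proof -
    have "x [^]\<^bsub>?G\<^esub> (k ^ n) = inv\<^bsub>?G\<^esub> (g [^]\<^bsub>?G\<^esub> n) \<otimes>\<^bsub>?G\<^esub> (x \<otimes>\<^bsub>?G\<^esub> g [^]\<^bsub>?G\<^esub> n)"
      unfolding iter[symmetric] using x g by (simp add: m_assoc[symmetric])
    then have "x [^]\<^bsub>?G\<^esub> (k ^ n) = ?h [^]\<^bsub>?G\<^esub> n \<otimes>\<^bsub>?G\<^esub> (x \<otimes>\<^bsub>?G\<^esub> g [^]\<^bsub>?G\<^esub> n)"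
      using g by (simp add: nat_pow_inv)
    then have "length (x [^]\<^bsub>?G\<^esub> (k ^ n)) \<le> n * length ?h + (length x + n * length g)"
      using len[of "?h [^]\<^bsub>?G\<^esub> n" "x \<otimes>\<^bsub>?G\<^esub> g [^]\<^bsub>?G\<^esub> n"] len[of x "g [^]\<^bsub>?G\<^esub> n"] lenp[of ?h n] lenp[of g n]
      by simp
    moreover have "2 ^ n \<le> k ^ n" using k by (rule power_mono) simp
    ultimately show ?thesis using K[of "k ^ n"] by (simp add: algebra_simps)
  qed
  then show False using not_exponential_le_linear by blast
qed

text \<open>Conjugation by \<open>g\<close> takes \<open>x\<close> to the inverse of its k-th power,
  so conjugation by the square of \<open>g\<close> takes it to the power with exponent
  \<open>k * k\<close>, which is the expanding case.\<close>

lemma free_group_no_inverting_expansion: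
  assumes x: "x \<in> carrier (free_group S)" and g: "g \<in> carrier (free_group S)" and k: "(k::nat) \<ge> 2"
    and rel: "x \<otimes>\<^bsub>free_group S\<^esub> g \<otimes>\<^bsub>free_group S\<^esub> x [^]\<^bsub>free_group S\<^esub> k = g"
  shows "x = []"
proof (rule free_group_no_expansion)
  interpret group "free_group S" by (rule group_free_group)
  note [simp del] = free_group_simps
  let ?G = "free_group S"
  show "x \<in> carrier ?G" "g \<otimes>\<^bsub>?G\<^esub> g \<in> carrier ?G" using x g by simp_all
  show "k * k \<ge> 2" using k mult_le_mono[OF k k] by simp
  have step: "x [^]\<^bsub>?G\<^esub> j \<otimes>\<^bsub>?G\<^esub> g \<otimes>\<^bsub>?G\<^esub> x [^]\<^bsub>?G\<^esub> (k * j) = g" for j :: nat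
  proof (induction j)
    case (Suc j)
    have "x [^]\<^bsub>?G\<^esub> Suc j \<otimes>\<^bsub>?G\<^esub> g \<otimes>\<^bsub>?G\<^esub> x [^]\<^bsub>?G\<^esub> (k * Suc j)
      = x [^]\<^bsub>?G\<^esub> j \<otimes>\<^bsub>?G\<^esub> (x \<otimes>\<^bsub>?G\<^esub> g \<otimes>\<^bsub>?G\<^esub> x [^]\<^bsub>?G\<^esub> k) \<otimes>\<^bsub>?G\<^esub> x [^]\<^bsub>?G\<^esub> (k * j)"
      using x g by (simp add: m_assoc nat_pow_mult)
    then show ?case unfolding rel using Suc by simp
  qed (use g in simp)
  have "x \<otimes>\<^bsub>?G\<^esub> (g \<otimes>\<^bsub>?G\<^esub> g) = x \<otimes>\<^bsub>?G\<^esub> g \<otimes>\<^bsub>?G\<^esub> (x [^]\<^bsub>?G\<^esub> k \<otimes>\<^bsub>?G\<^esub> g \<otimes>\<^bsub>?G\<^esub> x [^]\<^bsub>?G\<^esub> (k * k))"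
    unfolding step using x g by (simp add: m_assoc)
  also have "\<dots> = (x \<otimes>\<^bsub>?G\<^esub> g \<otimes>\<^bsub>?G\<^esub> x [^]\<^bsub>?G\<^esub> k) \<otimes>\<^bsub>?G\<^esub> g \<otimes>\<^bsub>?G\<^esub> x [^]\<^bsub>?G\<^esub> (k * k)"
    using x g by (simp add: m_assoc)
  finally show "x \<otimes>\<^bsub>?G\<^esub> (g \<otimes>\<^bsub>?G\<^esub> g) = g \<otimes>\<^bsub>?G\<^esub> g \<otimes>\<^bsub>?G\<^esub> x [^]\<^bsub>?G\<^esub> (k * k)"
    unfolding rel .
qed

text \<open>Commuting lists are powers of a common list \<open>z\<close>; its reduction is a common
  root in the free group.\<close>

lemma free_group_commuting_words_powers:
  assumes x: "x \<in> carrier (free_group S)" "x \<noteq> []" and y: "y \<in> carrier (free_group S)" "y \<noteq> []"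
    and comm: "x @ y = y @ x"
  shows "\<exists>m n. m > 0 \<and> n > 0 \<and> x [^]\<^bsub>free_group S\<^esub> (m::nat) = y [^]\<^bsub>free_group S\<^esub> (n::nat)"
proof -
  interpret group "free_group S" by (rule group_free_group)
  obtain m n z where z: "concat (replicate m z) = x" "concat (replicate n z) = y"
    using comm_append_are_replicate[OF comm] by blast
  have mn: "m > 0" "n > 0" using z x y by (auto intro!: gr0I)
  have "set z \<subseteq> set x" using z(1) mn(1) by (cases m) auto
  then have "snd ` set z \<subseteq> S" using x(1) by auto
  then have zm: "foldr prepend z [] \<in> carrier (free_group S)"
    using letters_foldr_prepend[of z "[]"] by (auto simp: reduced_foldr_prepend)
  have "x = foldr prepend z [] [^]\<^bsub>free_group S\<^esub> m" "y = foldr prepend z [] [^]\<^bsub>free_group S\<^esub> n"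
    using foldr_prepend_replicate[of m z S] foldr_prepend_replicate[of n z S] z
      foldr_prepend_reduced[of x] foldr_prepend_reduced[of y] x y by simp_all
  then have "x [^]\<^bsub>free_group S\<^esub> n = y [^]\<^bsub>free_group S\<^esub> m"
    using nat_pow_pow[OF zm] by (simp add: mult.commute)
  then show ?thesis using mn by blast
qed

text \<open>If neither product cancels, the two words commute as lists and are powers of a common list. If
  both cancel, either both words are conjugated by the same letter, or one of them and the inverse of the
  other commute without cancellation.\<close>

lemma free_group_commuting_powers:
  assumes "x \<in> carrier (free_group S)" "x \<noteq> []" "y \<in> carrier (free_group S)" "y \<noteq> []"
    and "x \<otimes>\<^bsub>free_group S\<^esub> y = y \<otimes>\<^bsub>free_group S\<^esub> x"
  shows "\<exists>m n. m > 0 \<and> n > 0 \<and> (x [^]\<^bsub>free_group S\<^esub> (m::nat) = y [^]\<^bsub>free_group S\<^esub> (n::nat) \<or>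
    x [^]\<^bsub>free_group S\<^esub> m \<otimes>\<^bsub>free_group S\<^esub> y [^]\<^bsub>free_group S\<^esub> n = \<one>\<^bsub>free_group S\<^esub>)"
  using assms
proof (induction "length x" arbitrary: x y rule: less_induct)
  case less
  interpret group "free_group S" by (rule group_free_group)
  let ?G = "free_group S"
  have x: "reduced x" "snd ` set x \<subseteq> S" and y: "reduced y" "snd ` set y \<subseteq> S"
    using less.prems by simp_all
  have comm: "foldr prepend x y = foldr prepend y x" using less.prems by simp
  have cancel: "length (foldr prepend u v) < length u + length v"
    if uv: "u \<noteq> []" "v \<noteq> []" "hd v = inv_letter (last u)" for u v :: "'a signed list"
  proof -
    obtain u' c where u: "u = u' @ [c]" using \<open>u \<noteq> []\<close> by (cases u rule: rev_cases) auto
    obtain v' where "v = inv_letter c # v'" using uv u by (cases v) auto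
    then show ?thesis using u length_foldr_prepend[of u' v'] by simp
  qed
  have nocancel: "foldr prepend u v = u @ v"
    if "reduced u" "reduced v" "hd v \<noteq> inv_letter (last u)" for u v :: "'a signed list"
    using that by (intro foldr_prepend_append_reduced) (simp add: reduced_append)
  \<comment> \<open>The two products are equal, hence of equal length, and the length drops below
    the sum exactly in case of cancellation. So either both cancel or neither does.\<close>
  consider (none) "hd y \<noteq> inv_letter (last x)" "hd x \<noteq> inv_letter (last y)"
    | (both) "hd y = inv_letter (last x)" "hd x = inv_letter (last y)"
    using cancel[of x y] cancel[of y x] nocancel[of x y] nocancel[of y x] x y less.prems comm
    by (metis add.commute length_append less_irrefl)
  then show ?case
  proof cases
    case none
    then have "x @ y = y @ x" using nocancel[of x y] nocancel[of y x] x y comm by simp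
    from free_group_commuting_words_powers[OF less.prems(1-4) this] show ?thesis by blast
  next
    case both
    define c d where "c = last x" and "d = last y"
    have hd: "hd x = inv_letter d" "hd y = inv_letter c" using both by (simp_all add: c_def d_def)
    show ?thesis
    proof (cases "c = d")
      case False
      \<comment> \<open>The inverse of \<open>x\<close> begins with the inverse of \<open>c\<close>
        and ends with \<open>d\<close>, just like \<open>y\<close>, so for distinct \<open>c\<close>
        and \<open>d\<close> neither of their products cancels.\<close>
      define xi where "xi = rev (map inv_letter x)"
      have "foldr prepend (rev (map inv_letter u)) u = []" for u :: "'a signed list"
        by (induction u) (auto simp: foldr_prepend_prepend)
      then have "xi \<otimes>\<^bsub>?G\<^esub> x = \<one>\<^bsub>?G\<^esub>" by (simp add: xi_def)
      moreover have "reduced (rev (map inv_letter u))" if "reduced u" for u :: "'a signed list"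
        using that
      proof (induction u)
        case (Cons a u)
        then show ?case by (cases u) (auto simp: reduced_Cons reduced_append)
      qed simp
      then have xi: "xi \<in> carrier ?G" using x by (auto simp: xi_def inv_letter_def)
      ultimately have inv: "inv\<^bsub>?G\<^esub> x = xi" using less.prems(1) by (intro inv_equality) auto
      have ends: "xi \<noteq> []" "hd xi = inv_letter c" "last xi = d"
        using less.prems(2) hd by (simp_all add: xi_def c_def hd_rev last_rev last_map hd_map)
      have "xi \<otimes>\<^bsub>?G\<^esub> y = y \<otimes>\<^bsub>?G\<^esub> xi"
        using less.prems(1,3,5) unfolding inv[symmetric]
        by (metis inv_closed inv_solve_left m_assoc m_closed inv_solve_right)
      moreover have "xi @ y = foldr prepend xi y" "y @ xi = foldr prepend y xi"
        using nocancel[of xi y] nocancel[of y xi] xi y ends hd False d_def by auto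
      ultimately have "xi @ y = y @ xi" by simp
      from free_group_commuting_words_powers[OF xi ends(1) less.prems(3,4) this]
      obtain m n where mn: "m > 0" "n > 0" "xi [^]\<^bsub>?G\<^esub> (m::nat) = y [^]\<^bsub>?G\<^esub> (n::nat)" by blast
      have "x [^]\<^bsub>?G\<^esub> m \<otimes>\<^bsub>?G\<^esub> y [^]\<^bsub>?G\<^esub> n = \<one>\<^bsub>?G\<^esub>"
        unfolding mn(3)[symmetric] inv[symmetric] using less.prems(1) by (simp add: nat_pow_inv del: free_group_simps)
      then show ?thesis using mn by blast
    next
      case True
      have cS: "snd c \<in> S" using x(2) less.prems(2) by (auto simp: c_def)
      have cm: "[c] \<in> carrier ?G" and ci: "inv\<^bsub>?G\<^esub> [c] = [inv_letter c]"
        using cS inv_free_group_single[OF cS] by (auto simp: reduced_Cons)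
      \<comment> \<open>Conjugation by \<open>c\<close> strips the outer letters of both words; the
        shorter first word permits the induction.\<close>
      have conj: "\<exists>u. u \<noteq> [] \<and> u \<in> carrier ?G \<and> length u < length z \<and>
          u = [c] \<otimes>\<^bsub>?G\<^esub> z \<otimes>\<^bsub>?G\<^esub> inv\<^bsub>?G\<^esub> [c]"
        if z: "z \<in> carrier ?G" "z \<noteq> []" "hd z = inv_letter c" "last z = c" for z
      proof -
        obtain z' where z': "z = inv_letter c # z'" using z by (cases z) auto
        have "z' \<noteq> []" using z z' by auto
        then obtain u where u: "z = inv_letter c # u @ [c]"
          using z z' by (cases z' rule: rev_cases) auto
        have "u \<noteq> []" using z(1) unfolding u by (auto simp: reduced_Cons)
        moreover have "u \<in> carrier ?G" using z(1) unfolding u by (auto simp: reduced_Cons reduced_append)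
        moreover have "[c] \<otimes>\<^bsub>?G\<^esub> z \<otimes>\<^bsub>?G\<^esub> inv\<^bsub>?G\<^esub> [c] = u"
        proof -
          have "[c] \<otimes>\<^bsub>?G\<^esub> z = u @ [c]" using u by simp
          moreover have "foldr prepend (u @ [c]) [inv_letter c] = foldr prepend u []" by simp
          ultimately show ?thesis using ci \<open>u \<in> carrier ?G\<close> foldr_prepend_reduced[of u] by simp
        qed
        ultimately show ?thesis using u by auto
      qed
      obtain u where u: "u \<noteq> []" "u \<in> carrier ?G" "length u < length x"
        "u = [c] \<otimes>\<^bsub>?G\<^esub> x \<otimes>\<^bsub>?G\<^esub> inv\<^bsub>?G\<^esub> [c]"
        using conj[of x] less.prems hd True c_def by blast
      obtain v where v: "v \<noteq> []" "v \<in> carrier ?G"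
        "v = [c] \<otimes>\<^bsub>?G\<^esub> y \<otimes>\<^bsub>?G\<^esub> inv\<^bsub>?G\<^esub> [c]"
        using conj[of y] less.prems hd True d_def by blast
      note [simp del] = free_group_simps
      have icm: "inv\<^bsub>?G\<^esub> [c] \<in> carrier ?G" using cm by simp
      have mult: "([c] \<otimes>\<^bsub>?G\<^esub> a \<otimes>\<^bsub>?G\<^esub> inv\<^bsub>?G\<^esub> [c]) \<otimes>\<^bsub>?G\<^esub> ([c] \<otimes>\<^bsub>?G\<^esub> b \<otimes>\<^bsub>?G\<^esub> inv\<^bsub>?G\<^esub> [c])
          = [c] \<otimes>\<^bsub>?G\<^esub> (a \<otimes>\<^bsub>?G\<^esub> b) \<otimes>\<^bsub>?G\<^esub> inv\<^bsub>?G\<^esub> [c]" if "a \<in> carrier ?G" "b \<in> carrier ?G" for a b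
      proof -
        have "inv\<^bsub>?G\<^esub> [c] \<otimes>\<^bsub>?G\<^esub> ([c] \<otimes>\<^bsub>?G\<^esub> e) = e" if "e \<in> carrier ?G" for e
          using that cm by (simp add: m_assoc[symmetric])
        then show ?thesis using that cm by (simp add: m_assoc)
      qed
      have inj: "a = b" if "a \<in> carrier ?G" "b \<in> carrier ?G"
        "[c] \<otimes>\<^bsub>?G\<^esub> a \<otimes>\<^bsub>?G\<^esub> inv\<^bsub>?G\<^esub> [c] = [c] \<otimes>\<^bsub>?G\<^esub> b \<otimes>\<^bsub>?G\<^esub> inv\<^bsub>?G\<^esub> [c]" for a b
        using that cm icm by (metis l_cancel m_closed r_cancel)
      have "u \<otimes>\<^bsub>?G\<^esub> v = v \<otimes>\<^bsub>?G\<^esub> u"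
        unfolding u(4) v(3) using mult less.prems by simp
      from less.hyps[OF u(3,2,1) v(2,1) this]
      obtain m n where mn: "m > 0" "n > 0" "u [^]\<^bsub>?G\<^esub> (m::nat) = v [^]\<^bsub>?G\<^esub> (n::nat) \<or>
          u [^]\<^bsub>?G\<^esub> m \<otimes>\<^bsub>?G\<^esub> v [^]\<^bsub>?G\<^esub> n = \<one>\<^bsub>?G\<^esub>" by blast
      have one: "\<one>\<^bsub>?G\<^esub> = [c] \<otimes>\<^bsub>?G\<^esub> \<one>\<^bsub>?G\<^esub> \<otimes>\<^bsub>?G\<^esub> inv\<^bsub>?G\<^esub> [c]" using cm by simp
      have "u [^]\<^bsub>?G\<^esub> m = [c] \<otimes>\<^bsub>?G\<^esub> x [^]\<^bsub>?G\<^esub> m \<otimes>\<^bsub>?G\<^esub> inv\<^bsub>?G\<^esub> [c]"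
        "v [^]\<^bsub>?G\<^esub> n = [c] \<otimes>\<^bsub>?G\<^esub> y [^]\<^bsub>?G\<^esub> n \<otimes>\<^bsub>?G\<^esub> inv\<^bsub>?G\<^esub> [c]"
        unfolding u(4) v(3) using pow_conj[OF cm] less.prems by blast+
      then have "x [^]\<^bsub>?G\<^esub> m = y [^]\<^bsub>?G\<^esub> n \<or> x [^]\<^bsub>?G\<^esub> m \<otimes>\<^bsub>?G\<^esub> y [^]\<^bsub>?G\<^esub> n = \<one>\<^bsub>?G\<^esub>"
        using mn(3) inj less.prems mult one by (metis m_closed nat_pow_closed one_closed)
      then show ?thesis using mn by blast
    qed
  qed
qed

lemma iso_comm_group:
  assumes "comm_group G" "group H" "G \<cong> H"
  shows "comm_group H"
proof -
  interpret comm_group G by fact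
  obtain h where h: "h \<in> Group.iso G H" using assms(3) by (auto simp: is_iso_def)
  then have "h \<one>\<^bsub>G\<^esub> = \<one>\<^bsub>H\<^esub>" using assms(2) is_group by (auto simp: Group.iso_def intro: hom_one)
  then show ?thesis using iso_imp_img_comm_group[OF h] by simp
qed

section \<open>Isomorphisms\<close>

lemma map_eq_inv_letter_iff:
  assumes "inj_on f S" "snd x \<in> S" "snd y \<in> S"
  shows "apsnd f y = inv_letter (apsnd f x) \<longleftrightarrow> y = inv_letter x"
  using assms by (cases x; cases y) (auto simp: inv_letter_def inj_on_eq_iff)

lemma map_foldr_prepend:
  assumes "inj_on f S" "snd ` set v \<subseteq> S" "snd ` set w \<subseteq> S"
  shows "foldr prepend (map (apsnd f) v) (map (apsnd f) w) =
    map (apsnd f) (foldr prepend v w)"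
  using assms
proof (induction v)
  case (Cons x v)
  let ?u = "foldr prepend v w"
  have "snd ` set ?u \<subseteq> S" using order_trans[OF letters_foldr_prepend[of v w]] Cons.prems by simp
  then have "prepend (apsnd f x) (map (apsnd f) ?u) = map (apsnd f) (prepend x ?u)"
  proof (cases ?u)
    case (Cons y u)
    then have "snd y \<in> S" using \<open>snd ` set ?u \<subseteq> S\<close> by simp
    then show ?thesis using Cons Cons.prems map_eq_inv_letter_iff[OF assms(1), of x y] by simp
  qed simp
  then show ?case using Cons by simp
qed simp

lemma reduced_map:
  assumes "inj_on f S" "snd ` set w \<subseteq> S"
  shows "reduced (map (apsnd f) w) = reduced w"
  using assms
proof (induction w)
  case (Cons x w)
  then show ?case using map_eq_inv_letter_iff[OF assms(1), of x "hd w"]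
    by (cases w) (simp_all add: reduced_Cons)
qed simp

lemma free_group_cong:
  assumes "bij_betw f S T"
  shows "free_group S \<cong> free_group T"
proof (rule is_isoI, rule isoI)
  let ?h = "map (apsnd f)" and ?k = "map (apsnd (inv_into S f))"
  have inj: "inj_on f S" and img: "f ` S = T" using assms by (auto simp: bij_betw_def)
  have inj': "inj_on (inv_into S f) T" and img': "inv_into S f ` T = S"
    using assms by (auto simp: inj_on_inv_into bij_betw_def inv_into_image_cancel)
  have mem: "?h w \<in> carrier (free_group T)" if "w \<in> carrier (free_group S)" for w
    using that img reduced_map[OF inj, of w] by (force simp: image_subset_iff)
  have mem': "?k w \<in> carrier (free_group S)" if "w \<in> carrier (free_group T)" for w
    using that img' reduced_map[OF inj', of w] by (force simp: image_subset_iff)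
  show "?h \<in> hom (free_group S) (free_group T)"
  proof (rule homI)
    show "?h (v \<otimes>\<^bsub>free_group S\<^esub> w) = ?h v \<otimes>\<^bsub>free_group T\<^esub> ?h w"
      if "v \<in> carrier (free_group S)" "w \<in> carrier (free_group S)" for v w
      using that map_foldr_prepend[OF inj, of v w] by simp
  qed (rule mem)
  show "bij_betw ?h (carrier (free_group S)) (carrier (free_group T))"
  proof (rule bij_betw_byWitness[where f' = ?k])
    show "\<forall>w\<in>carrier (free_group S). ?k (?h w) = w"
    proof
      fix w assume "w \<in> carrier (free_group S)"
      then have "\<forall>x\<in>set w. (apsnd (inv_into S f) \<circ> apsnd f) x = id x" using inj by (auto simp: image_subset_iff)
      then have "map (apsnd (inv_into S f) \<circ> apsnd f) w = map id w" unfolding map_eq_conv .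
      then show "?k (?h w) = w" by simp
    qed
    show "\<forall>w\<in>carrier (free_group T). ?h (?k w) = w"
    proof
      fix w assume "w \<in> carrier (free_group T)"
      then have "\<forall>x\<in>set w. (apsnd f \<circ> apsnd (inv_into S f)) x = id x"
        using img by (auto simp: image_subset_iff f_inv_into_f)
      then have "map (apsnd f \<circ> apsnd (inv_into S f)) w = map id w" unfolding map_eq_conv .
      then show "?h (?k w) = w" by simp
    qed
  qed (use mem mem' in blast)+
qed

text \<open>The isomorphism evaluates reduced words: nonempty ones act nontrivially, and free
  reduction does not change the action, so every group element is reached.\<close>

lemma aleshin_vorobets_iso_free_group:
  "free_group (UNIV :: state set) \<cong> automaton_group aleshin_vorobets"
proof (rule is_isoI, rule isoI)
  let ?f = "word_act aleshin_vorobets" and ?F = "free_group (UNIV :: state set)"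
  let ?G = "automaton_group aleshin_vorobets"
  interpret group_hom ?F ?G ?f
    unfolding group_hom_def group_hom_axioms_def
    by (auto simp: group_free_group group_automaton_group hom_def carrier_automaton_group word_act_foldr_prepend)
  show "?f \<in> hom ?F ?G" by (rule homh)
  have "inj_on ?f (carrier ?F)"
    using inj_iff_trivial_ker word_act_aleshin_vorobets_neq_id by (auto simp: kernel_def)
  moreover have "word_act aleshin_vorobets w \<in> ?f ` carrier ?F" for w
  proof
    show "word_act aleshin_vorobets w = ?f (foldr prepend w [])" by (simp add: word_act_foldr_prepend)
  qed (simp add: reduced_foldr_prepend)
  ultimately show "bij_betw ?f (carrier ?F) (carrier ?G)"
    by (auto simp: bij_betw_def carrier_automaton_group)
qed

section \<open>Invariance of the automaton group under symmetries\<close>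

lemma automaton_group_eqI:
  assumes "range (word_act A) = range (word_act B)"
  shows "automaton_group A = automaton_group B"
  using assms carrier_automaton_group[of A] carrier_automaton_group[of B]
  by (simp add: automaton_group_def subgroup_generated_def)

lemma letter_act_inverse: "letter_act (inverse_automaton A) x = letter_act A (inv_letter x)"
  by (simp add: letter_act_def inv_letter_def inverse_automaton_involution)

lemma automaton_group_inverse: "automaton_group (inverse_automaton A) = automaton_group A"
proof (rule automaton_group_eqI)
  have w: "word_act (inverse_automaton A) w = word_act A (map inv_letter w)" for w A
    by (induction w) (auto simp: letter_act_inverse)
  have "word_act A w = word_act (inverse_automaton A) (map inv_letter w)" for w
    using w[of "inverse_automaton A" w] by (simp add: inverse_automaton_involution)
  then have "word_act A v \<in> range (word_act (inverse_automaton A))" for v by (metis rangeI)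
  moreover have "word_act (inverse_automaton A) v \<in> range (word_act A)" for v unfolding w by (rule rangeI)
  ultimately show "range (word_act (inverse_automaton A)) = range (word_act A)" by blast
qed

lemma automaton_group_rename:
  assumes "bij \<pi>"
  shows "automaton_group (rename_states \<pi> A) = automaton_group A"
proof (rule automaton_group_eqI)
  have i: "inverse_automaton (rename_states \<pi> A) = rename_states \<pi> (inverse_automaton A)"
    by (auto simp: inverse_automaton_def rename_states_def fun_eq_iff split: prod.splits)
  have "letter_act (rename_states \<pi> A) (apsnd \<pi> x) = letter_act A x" for x
    using act_rename[OF assms] by (cases x) (auto simp: letter_act_def i fun_eq_iff)
  then have w: "word_act (rename_states \<pi> A) (map (apsnd \<pi>) w) = word_act A w" for w
    by (induction w) auto
  have "x = apsnd \<pi> (apsnd (inv_into UNIV \<pi>) x)" for x :: "state signed"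
    using assms by (cases x) (simp add: bij_is_surj surj_f_inv_f)
  then have "\<exists>v. w = map (apsnd \<pi>) v" for w :: "state signed list"
    unfolding ex_map_conv by metis
  then have "range (word_act (rename_states \<pi> A)) =
      (\<lambda>w. word_act (rename_states \<pi> A) (map (apsnd \<pi>) w)) ` UNIV"
    by (auto simp: image_iff) metis
  then show "range (word_act (rename_states \<pi> A)) = range (word_act A)" unfolding w .
qed

text \<open>Letterwise negation conjugates one group into the other, whereas the other two
  symmetries keep the set of group elements itself.\<close>

lemma automaton_group_swap_iso: "automaton_group A \<cong> automaton_group (swap_letters A)"
proof (rule is_isoI, rule isoI)
  let ?h = "\<lambda>f v. map Not (f (map Not v))"
  have i: "inverse_automaton (swap_letters A) = swap_letters (inverse_automaton A)"
    by (auto simp: inverse_automaton_def swap_letters_def fun_eq_iff split: prod.splits)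
  have nn0: "Not \<circ> Not = id" by (simp add: fun_eq_iff)
  then have nn: "map Not (map Not v) = v" for v by simp
  have l: "letter_act (swap_letters A) x v = map Not (letter_act A x (map Not v))" for x v
    using act_swap[of A "snd x" "map Not v", unfolded nn]
      act_swap[of "inverse_automaton A" "snd x" "map Not v", unfolded nn]
    by (simp add: letter_act_def i)
  have w: "word_act (swap_letters A) w = ?h (word_act A w)" for w
    by (induction w) (auto simp: l nn0 fun_eq_iff)
  show "?h \<in> hom (automaton_group A) (automaton_group (swap_letters A))"
    by (rule homI) (auto simp: carrier_automaton_group w[symmetric] fun_eq_iff nn0)
  have hh: "?h (?h f) = f" for f by (simp add: nn0)
  have "?h ` range (word_act A) = range (word_act (swap_letters A))"
    by (simp add: w image_image)
  moreover have "inj ?h"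
    by (rule inj_on_inverseI[where g = ?h]) (rule hh)
  ultimately show "bij_betw ?h (carrier (automaton_group A)) (carrier (automaton_group (swap_letters A)))"
    by (auto simp: bij_betw_def carrier_automaton_group intro: inj_on_subset)
qed

lemma symmetric_automata_iso:
  assumes "symmetric_automata A B"
  shows "automaton_group A \<cong> automaton_group B"
  using assms unfolding symmetric_automata_def
proof (induction rule: rtranclp_induct)
  case base
  show ?case using iso_set_refl by (rule is_isoI)
next
  case (step B C)
  have "automaton_group B \<cong> automaton_group C"
    using step(2)
  proof cases
    case inverse
    then show ?thesis using iso_set_refl by (simp add: automaton_group_inverse is_isoI)
  next
    case (rename \<pi>)
    then show ?thesis using iso_set_refl by (simp add: automaton_group_rename is_isoI)
  next
    case swap
    then show ?thesis by (simp add: automaton_group_swap_iso)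
  qed
  then show ?case using step.IH iso_trans by blast
qed

section \<open>Free nonabelian automaton groups and isomorphisms\<close>

definition free_nonabelian :: "automaton \<Rightarrow> bool" where
  "free_nonabelian A \<longleftrightarrow> is_free_group (automaton_group A) \<and> \<not> comm_group (automaton_group A)"

lemma is_free_group_iso:
  assumes "is_free_group G" "group G" "H \<cong> (G :: ('a, 'c) monoid_scheme)"
  shows "is_free_group (H :: ('a, 'b) monoid_scheme)"
  using assms iso_trans unfolding is_free_group_def by blast

lemma free_nonabelian_iso:
  assumes "automaton_group A \<cong> automaton_group B" "free_nonabelian A"
  shows "free_nonabelian B"
proof -
  have ba: "automaton_group B \<cong> automaton_group A"
    by (rule group.iso_sym[OF group_automaton_group assms(1)])
  then show ?thesis using assms(2) is_free_group_iso[OF _ group_automaton_group ba]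
      iso_comm_group[OF _ group_automaton_group ba] by (auto simp: free_nonabelian_def)
qed

lemma free_nonabelian_aleshin_vorobets: "free_nonabelian aleshin_vorobets"
  "automaton_group aleshin_vorobets \<cong> free_group {..<3::nat}"
proof -
  let ?G = "automaton_group aleshin_vorobets"
  have G: "?G \<cong> free_group (UNIV :: state set)"
    by (rule group.iso_sym[OF group_free_group aleshin_vorobets_iso_free_group])
  have u: "(UNIV :: state set) = {Sa, Sb, Sc}" by (auto intro: state.exhaust)
  have "card (UNIV :: state set) = card {..<3::nat}" by (simp add: u)
  then obtain f :: "state \<Rightarrow> nat" where "bij_betw f UNIV {..<3}"
    using finite_same_card_bij[of "UNIV :: state set" "{..<3::nat}"] u by (metis finite.simps finite_lessThan)
  then show "?G \<cong> free_group {..<3::nat}" using G free_group_cong iso_trans by blast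
  have neq: "word_act aleshin_vorobets [(True, q), (True, r)] \<noteq> word_act aleshin_vorobets [(True, r), (True, q)]"
    if "q \<noteq> r" for q r
  proof
    assume "word_act aleshin_vorobets [(True, q), (True, r)] = word_act aleshin_vorobets [(True, r), (True, q)]"
    then have "word_act aleshin_vorobets ([(True, q), (True, r)] @ [(False, q), (False, r)])
      = word_act aleshin_vorobets ([(True, r), (True, q)] @ [(False, q), (False, r)])"
      by (simp only: word_act_append)
    also have "\<dots> = letter_act aleshin_vorobets (True, r) \<circ> (letter_act aleshin_vorobets (True, q) \<circ>
       letter_act aleshin_vorobets (inv_letter (True, q))) \<circ> letter_act aleshin_vorobets (inv_letter (True, r))"
      by (simp add: comp_assoc inv_letter_def)
    also have "\<dots> = id" by (simp only: letter_act_inv comp_id)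
    finally show False
      using word_act_aleshin_vorobets_neq_id[of "[(True, q), (True, r), (False, q), (False, r)]"] that
      by (simp add: reduced_Cons inv_letter_def)
  qed
  \<comment> \<open>\<open>is_free_group\<close> asks for a basis in the element type of the group;
    injectivity replaces the three states by their actions.\<close>
  have "inj (act aleshin_vorobets)"
  proof (rule injI, rule ccontr)
    fix q r assume "act aleshin_vorobets q = act aleshin_vorobets r" "q \<noteq> r"
    then show False using neq[of q r] by (simp add: letter_act_def)
  qed
  then have "bij_betw (act aleshin_vorobets) UNIV (range (act aleshin_vorobets))"
    by (simp add: bij_betw_imageI)
  then have "is_free_group ?G"
    using G free_group_cong iso_trans unfolding is_free_group_def by blast
  moreover have "\<not> comm_group ?G"
  proof
    assume "comm_group ?G"
    then interpret comm_group ?G .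
    have "word_act aleshin_vorobets [(True, q)] \<in> carrier ?G" for q
      by (simp only: carrier_automaton_group) (rule rangeI)
    from m_comm[OF this[of Sa] this[of Sb]]
    show False using neq[of Sa Sb] by simp
  qed
  ultimately show "free_nonabelian aleshin_vorobets" by (simp add: free_nonabelian_def)
qed

section \<open>Obstructions to freeness\<close>

definition inv_word :: "'a signed list \<Rightarrow> 'a signed list" where
  "inv_word w = rev (map inv_letter w)"

lemma word_act_inv_word: "word_act A w \<circ> word_act A (inv_word w) = id"
proof (induction w)
  case (Cons x w)
  have "word_act A (x # w) \<circ> word_act A (inv_word (x # w)) =
      letter_act A x \<circ> (word_act A w \<circ> word_act A (inv_word w)) \<circ> letter_act A (inv_letter x)"
    by (simp add: inv_word_def word_act_append comp_assoc)
  also have "\<dots> = id" by (simp only: Cons comp_id letter_act_inv)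
  finally show ?case .
qed (simp add: inv_word_def)

lemma inv_word_inv_word [simp]: "inv_word (inv_word w) = w"
  by (simp add: inv_word_def rev_map comp_def)

lemma word_act_eq_iff: "word_act A v = word_act A w \<longleftrightarrow> word_act A (v @ inv_word w) = id"
proof
  assume "word_act A (v @ inv_word w) = id"
  then have "word_act A v \<circ> word_act A (inv_word w) \<circ> word_act A w = word_act A w"
    by (simp add: word_act_append)
  moreover have "word_act A (inv_word w) \<circ> word_act A w = id"
    using word_act_inv_word[of A "inv_word w"] by simp
  ultimately show "word_act A v = word_act A w" by (simp add: comp_assoc)
qed (simp add: word_act_append word_act_inv_word)

lemma word_act_funpow: "word_act A w ^^ n = word_act A (concat (replicate n w))"
  by (induction n) (auto simp: word_act_append)

lemma is_free_automaton_groupE: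
  assumes "is_free_group (automaton_group A)"
  obtains S :: "(bool list \<Rightarrow> bool list) set" and h where
    "group_hom (automaton_group A) (free_group S) h" "inj_on h (carrier (automaton_group A))"
proof -
  obtain S :: "(bool list \<Rightarrow> bool list) set" and h where h: "h \<in> Group.iso (automaton_group A) (free_group S)"
    using assms by (auto simp: is_free_group_def is_iso_def)
  then have "group_hom (automaton_group A) (free_group S) h"
    by (auto simp: group_hom_def group_hom_axioms_def Group.iso_def group_automaton_group group_free_group)
  then show thesis using that h by (auto simp: iso_iff)
qed

section \<open>Consequences of freeness for relations between words\<close>

context
  fixes A :: automaton
  assumes free: "is_free_group (automaton_group A)"
begin

lemma free_automaton_group_torsion_free:
  assumes "word_act A w ^^ n = id" "n > 0"
  shows "word_act A w = id"
proof -
  obtain S :: "(bool list \<Rightarrow> bool list) set" and h where "group_hom (automaton_group A) (free_group S) h"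
    and inj: "inj_on h (carrier (automaton_group A))" by (rule is_free_automaton_groupE[OF free])
  then interpret group_hom "automaton_group A" "free_group S" h by blast
  let ?f = "word_act A w"
  have f: "?f \<in> carrier (automaton_group A)" "id \<in> carrier (automaton_group A)"
    by (simp add: carrier_automaton_group) (use G.one_closed in simp)
  have "h ?f [^]\<^bsub>free_group S\<^esub> n = h (?f [^]\<^bsub>automaton_group A\<^esub> n)" using hom_nat_pow[OF f(1)] by simp
  also have "\<dots> = []" using hom_one assms(1) by (simp add: pow_automaton_group)
  finally have "h ?f = []" using free_group_torsion_free[OF hom_closed[OF f(1)] assms(2)] by simp
  then have "h ?f = h id" using hom_one by simp
  then show ?thesis using inj f by (auto dest: inj_onD)
qed

lemma free_automaton_group_commuting_powers:
  assumes "word_act A v \<circ> word_act A w = word_act A w \<circ> word_act A v"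
    "word_act A v \<noteq> id" "word_act A w \<noteq> id"
  shows "\<exists>m n. m > 0 \<and> n > 0 \<and> (word_act A v ^^ m = word_act A w ^^ n \<or> word_act A v ^^ m \<circ> word_act A w ^^ n = id)"
proof -
  obtain S :: "(bool list \<Rightarrow> bool list) set" and h where "group_hom (automaton_group A) (free_group S) h"
    and inj: "inj_on h (carrier (automaton_group A))" by (rule is_free_automaton_groupE[OF free])
  then interpret group_hom "automaton_group A" "free_group S" h by blast
  let ?f = "word_act A v" and ?g = "word_act A w"
  have mem: "?f \<in> carrier (automaton_group A)" "?g \<in> carrier (automaton_group A)" "id \<in> carrier (automaton_group A)"
    by (simp_all add: carrier_automaton_group) (use G.one_closed carrier_automaton_group in simp)
  have h1: "h id = []" using hom_one by simp
  then have ne: "h ?f \<noteq> []" "h ?g \<noteq> []" using assms(2,3) inj mem by (metis inj_onD)+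
  have "h ?f \<otimes>\<^bsub>free_group S\<^esub> h ?g = h ?g \<otimes>\<^bsub>free_group S\<^esub> h ?f"
    using hom_mult[OF mem(1,2)] hom_mult[OF mem(2,1)] assms(1) by simp
  from free_group_commuting_powers[OF hom_closed[OF mem(1)] ne(1) hom_closed[OF mem(2)] ne(2) this]
  obtain m n where mn: "m > 0" "n > 0" "h ?f [^]\<^bsub>free_group S\<^esub> (m::nat) = h ?g [^]\<^bsub>free_group S\<^esub> (n::nat) \<or>
    h ?f [^]\<^bsub>free_group S\<^esub> m \<otimes>\<^bsub>free_group S\<^esub> h ?g [^]\<^bsub>free_group S\<^esub> n = \<one>\<^bsub>free_group S\<^esub>" by blast
  have p: "?f ^^ m \<in> carrier (automaton_group A)" "?g ^^ n \<in> carrier (automaton_group A)"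
    by (simp_all add: word_act_funpow carrier_automaton_group)
  have hp: "h ?f [^]\<^bsub>free_group S\<^esub> m = h (?f ^^ m)" "h ?g [^]\<^bsub>free_group S\<^esub> n = h (?g ^^ n)"
    using hom_nat_pow[OF mem(1), of m] hom_nat_pow[OF mem(2), of n] by (simp_all add: pow_automaton_group)
  have "h (?f ^^ m) \<otimes>\<^bsub>free_group S\<^esub> h (?g ^^ n) = h (?f ^^ m \<circ> ?g ^^ n)"
    using hom_mult[OF p] by simp
  moreover have "?f ^^ m \<circ> ?g ^^ n \<in> carrier (automaton_group A)"
    using G.m_closed[OF p] by simp
  ultimately have "?f ^^ m = ?g ^^ n \<or> ?f ^^ m \<circ> ?g ^^ n = id"
    using mn(3) inj p mem(3) h1 unfolding hp by (metis free_group_simps(3) inj_onD)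
  then show ?thesis using mn by blast
qed

lemma free_automaton_group_no_expansion:
  assumes "word_act A v \<circ> word_act A w = word_act A w \<circ> word_act A v ^^ k \<or>
      word_act A v \<circ> word_act A w \<circ> word_act A v ^^ k = word_act A w" "k \<ge> 2"
  shows "word_act A v = id"
proof -
  obtain S :: "(bool list \<Rightarrow> bool list) set" and h where "group_hom (automaton_group A) (free_group S) h"
    and inj: "inj_on h (carrier (automaton_group A))" by (rule is_free_automaton_groupE[OF free])
  then interpret group_hom "automaton_group A" "free_group S" h by blast
  let ?f = "word_act A v" and ?g = "word_act A w"
  have mem: "?f \<in> carrier (automaton_group A)" "?g \<in> carrier (automaton_group A)" "id \<in> carrier (automaton_group A)"
    by (simp_all add: carrier_automaton_group) (use G.one_closed carrier_automaton_group in simp)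
  have p: "?f ^^ k \<in> carrier (automaton_group A)" by (simp add: word_act_funpow carrier_automaton_group)
  have hp: "h ?f [^]\<^bsub>free_group S\<^esub> k = h (?f ^^ k)"
    using hom_nat_pow[OF mem(1), of k] by (simp add: pow_automaton_group)
  have fg: "?f \<circ> ?g \<in> carrier (automaton_group A)" using G.m_closed[OF mem(1,2)] by simp
  have "h ?f \<otimes>\<^bsub>free_group S\<^esub> h ?g = h (?f \<circ> ?g)"
    "h ?g \<otimes>\<^bsub>free_group S\<^esub> h ?f [^]\<^bsub>free_group S\<^esub> k = h (?g \<circ> ?f ^^ k)"
    using hom_mult[OF mem(1,2)] hom_mult[OF mem(2) p] unfolding hp by simp_all
  moreover have "h (?f \<circ> ?g) \<otimes>\<^bsub>free_group S\<^esub> h ?f [^]\<^bsub>free_group S\<^esub> k = h (?f \<circ> ?g \<circ> ?f ^^ k)"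
    using hom_mult[OF fg p] unfolding hp by simp
  ultimately have "h ?f \<otimes>\<^bsub>free_group S\<^esub> h ?g = h ?g \<otimes>\<^bsub>free_group S\<^esub> h ?f [^]\<^bsub>free_group S\<^esub> k \<or>
      h ?f \<otimes>\<^bsub>free_group S\<^esub> h ?g \<otimes>\<^bsub>free_group S\<^esub> h ?f [^]\<^bsub>free_group S\<^esub> k = h ?g"
    using assms(1) by presburger
  then have "h ?f = []"
    using free_group_no_expansion[OF hom_closed[OF mem(1)] hom_closed[OF mem(2)] assms(2)]
      free_group_no_inverting_expansion[OF hom_closed[OF mem(1)] hom_closed[OF mem(2)] assms(2)] by blast
  then have "h ?f = h id" using hom_one by simp
  then show ?thesis using inj mem by (auto dest: inj_onD)
qed

end

lemma out_eq: "out A w s = (s \<noteq> out A w False)"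
  by (induction w) auto

lemma funpow_fixed: "f x = x \<Longrightarrow> (f ^^ n) x = x"
  by (induction n) auto

lemma funpow_word_act_Cons: "out A w s = s \<Longrightarrow> \<exists>y. (word_act A w ^^ n) (s # x) = s # y"
  by (induction n) (auto simp: word_act_Cons)

text \<open>If some element of the group moves the letters, a nontrivial element acting trivially below one
  of them has a conjugate with disjoint support, and the two generate a free abelian group of rank 2.\<close>

lemma trivial_section_not_free:
  assumes act: "fst (A q)" and w: "word_act A w \<noteq> id" "out A w s = s" "word_act A (section_word A w s) = id"
  shows "\<not> is_free_group (automaton_group A)"
proof
  assume free: "is_free_group (automaton_group A)"
  \<comment> \<open>The state \<open>q\<close> exchanges the letters, so this conjugate of
    \<open>w\<close> acts trivially below the letter other than \<open>s\<close>.\<close>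
  define v where "v = [(False, q)] @ w @ [(True, q)]"
  have w_fix: "word_act A w (s # x) = s # x" for x
    using w by (simp add: word_act_Cons)
  have inv1: "letter_act A (False, q) \<circ> letter_act A (True, q) = id"
    and inv2: "letter_act A (True, q) \<circ> letter_act A (False, q) = id"
    using letter_act_inv[of A "(False, q)"] letter_act_inv[of A "(True, q)"] by (simp_all add: inv_letter_def)
  have v_def': "word_act A v = letter_act A (False, q) \<circ> word_act A w \<circ> letter_act A (True, q)"
    by (simp add: v_def word_act_append comp_assoc)
  have v_fix: "word_act A v ((\<not> s) # x) = (\<not> s) # x" for x
  proof -
    have "letter_act A (True, q) ((\<not> s) # x) = s # letter_act A (letter_section A (True, q) (\<not> s)) x"
      using act by (simp add: letter_act_Cons del: letter_section.simps)
    then have "word_act A v ((\<not> s) # x) = (letter_act A (False, q) \<circ> letter_act A (True, q)) ((\<not> s) # x)"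
      using w_fix unfolding v_def' by simp
    then show ?thesis unfolding inv1 by simp
  qed
  have "word_act A v \<noteq> id"
  proof
    assume "word_act A v = id"
    have "word_act A w = (letter_act A (True, q) \<circ> letter_act A (False, q)) \<circ> word_act A w \<circ>
       (letter_act A (True, q) \<circ> letter_act A (False, q))" unfolding inv2 by simp
    also have "\<dots> = letter_act A (True, q) \<circ> word_act A v \<circ> letter_act A (False, q)"
      unfolding v_def' by (simp only: comp_assoc)
    also have "\<dots> = id" unfolding \<open>word_act A v = id\<close> using inv2 by simp
    finally show False using w(1) by blast
  qed
  have out_w: "out A w t = t" for t using w(2) out_eq[of A w t] out_eq[of A w s] by auto
  have "out A v (\<not> s) = (\<not> s)" using v_fix[of "[]"] by (simp add: word_act_Cons)
  then have out_v: "out A v t = t" for t using out_eq[of A v t] out_eq[of A v "\<not> s"] by auto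
  have "word_act A w \<circ> word_act A v = word_act A v \<circ> word_act A w"
  proof
    fix x show "(word_act A w \<circ> word_act A v) x = (word_act A v \<circ> word_act A w) x"
    proof (cases x)
      case (Cons t y)
      show ?thesis
      proof (cases "t = s")
        case True
        have "\<exists>z. word_act A v (s # y) = s # z" using out_v by (simp add: word_act_Cons)
        then show ?thesis using Cons True w_fix by auto
      next
        case False
        then have t: "t = (\<not> s)" by blast
        have "\<exists>z. word_act A w ((\<not> s) # y) = (\<not> s) # z" using out_w by (simp add: word_act_Cons)
        then show ?thesis using Cons t v_fix by auto
      qed
    qed simp
  qed
  from free_automaton_group_commuting_powers[OF free this w(1) \<open>word_act A v \<noteq> id\<close>]
  obtain m n where mn: "m > 0" "n > 0"
    "word_act A w ^^ m = word_act A v ^^ n \<or> word_act A w ^^ m \<circ> word_act A v ^^ n = id" by blast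
  have wp: "(word_act A w ^^ m) (s # x) = s # x" and vp: "(word_act A v ^^ n) ((\<not> s) # x) = (\<not> s) # x" for x
    using funpow_fixed[of "word_act A w", OF w_fix] funpow_fixed[of "word_act A v", OF v_fix] by blast+
  have Nil: "(word_act A u ^^ k) [] = []" for u k using funpow_fixed[of "word_act A u" "[]"] by simp
  from mn(3) show False
  proof
    \<comment> \<open>One side fixes everything below \<open>s\<close>, the other everything below
      the other letter, so the common power fixes the whole tree.\<close>
    assume eq: "word_act A w ^^ m = word_act A v ^^ n"
    have "(word_act A w ^^ m) x = id x" for x
    proof (cases x)
      case (Cons t y)
      then show ?thesis using wp[of y] vp[of y] unfolding eq by (cases "t = s") auto
    qed (simp add: Nil)
    then have "word_act A w ^^ m = id" by blast
    then show False using free_automaton_group_torsion_free[OF free _ mn(1)] w(1) by blast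
  next
    \<comment> \<open>The power of \<open>v\<close> preserves the subtree below \<open>s\<close>,
      where that of \<open>w\<close> is the identity; the relation then makes the power of
      \<open>v\<close> trivial there too.\<close>
    assume eq: "word_act A w ^^ m \<circ> word_act A v ^^ n = id"
    have "(word_act A v ^^ n) x = id x" for x
    proof (cases x)
      case (Cons t y)
      show ?thesis
      proof (cases "t = s")
        case True
        obtain z where z: "(word_act A v ^^ n) (s # y) = s # z"
          using funpow_word_act_Cons[OF out_v[of s]] by blast
        have "(word_act A w ^^ m) ((word_act A v ^^ n) (s # y)) = s # y"
          using fun_cong[OF eq, of "s # y"] by simp
        then show ?thesis using z wp Cons True by simp
      next
        case False
        then show ?thesis using vp Cons by simp
      qed
    qed (simp add: Nil)
    then have "word_act A v ^^ n = id" by blast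
    then show False using free_automaton_group_torsion_free[OF free _ mn(2)] \<open>word_act A v \<noteq> id\<close> by blast
  qed
qed

lemma commuting_generators_comm_group:
  assumes "\<And>q r. act A q \<circ> act A r = act A r \<circ> act A q"
  shows "comm_group (automaton_group A)"
proof -
  have swap: "f \<circ> letter_act A x = letter_act A x \<circ> f"
    if "\<And>q. f \<circ> act A q = act A q \<circ> f" for f x
  proof (cases "fst x")
    case True
    then show ?thesis using that by (simp add: letter_act_def)
  next
    case False
    then obtain q where x: "x = (False, q)" by (cases x) auto
    have i: "letter_act A x \<circ> act A q = id" "act A q \<circ> letter_act A x = id"
      using letter_act_inv[of A "(False, q)"] letter_act_inv[of A "(True, q)"]
      by (simp_all add: x inv_letter_def letter_act_def)
    have "f \<circ> letter_act A x = (letter_act A x \<circ> act A q) \<circ> (f \<circ> letter_act A x)" unfolding i by simp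
    also have "\<dots> = letter_act A x \<circ> (f \<circ> act A q) \<circ> letter_act A x" unfolding that by (simp only: comp_assoc)
    also have "\<dots> = letter_act A x \<circ> f \<circ> (act A q \<circ> letter_act A x)" by (simp only: comp_assoc)
    finally show ?thesis unfolding i by simp
  qed
  have l: "letter_act A x \<circ> letter_act A y = letter_act A y \<circ> letter_act A x" for x y
    by (rule swap) (use swap[of "act A _" x] assms in metis)
  have lw: "letter_act A x \<circ> word_act A w = word_act A w \<circ> letter_act A x" for x w
  proof (induction w)
    case (Cons y w)
    have "letter_act A x \<circ> word_act A (y # w) = (letter_act A x \<circ> letter_act A y) \<circ> word_act A w"
      by (simp only: word_act.simps comp_assoc)
    also have "\<dots> = letter_act A y \<circ> (letter_act A x \<circ> word_act A w)" unfolding l[of x y] by (simp only: comp_assoc)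
    finally show ?case unfolding Cons by (simp only: word_act.simps comp_assoc)
  qed simp
  have ww: "word_act A v \<circ> word_act A w = word_act A w \<circ> word_act A v" for v w
  proof (induction v)
    case (Cons y v)
    have "word_act A (y # v) \<circ> word_act A w = letter_act A y \<circ> (word_act A v \<circ> word_act A w)"
      by (simp only: word_act.simps comp_assoc)
    also have "\<dots> = (letter_act A y \<circ> word_act A w) \<circ> word_act A v" unfolding Cons by (simp only: comp_assoc)
    finally show ?case unfolding lw by (simp only: word_act.simps comp_assoc)
  qed simp
  show ?thesis
    by (rule group.group_comm_groupI[OF group_automaton_group]) (auto simp: carrier_automaton_group ww)
qed

text \<open>Depth-first search for an active section of the words in \<open>todo\<close>, with fuel \<open>n\<close>: the answers
  \<open>Some True\<close> and \<open>Some False\<close> certify triviality and nontriviality, and \<open>None\<close> certifies nothing.\<close>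

fun explore :: "automaton \<Rightarrow> nat \<Rightarrow> state signed list list \<Rightarrow> state signed list list \<Rightarrow> bool option" where
  "explore A 0 done todo = None"
| "explore A (Suc n) done [] = Some True"
| "explore A (Suc n) done (w # todo) =
    (if w \<in> set done then explore A n done todo
     else if out A w False then Some False
     else explore A n (w # done) (section_word A w False # section_word A w True # todo))"

text \<open>A nontrivial action would show at the first letter of some iterated section, but all of
  these stay in \<open>D\<close>, whose members fix the first letter.\<close>

lemma sections_closed_trivial:
  assumes "\<And>w. w \<in> D \<Longrightarrow> \<not> out A w False \<and> section_word A w False \<in> D \<and> section_word A w True \<in> D"
    and "w \<in> D"
  shows "word_act A w = id"
proof
  fix v show "word_act A w v = id v" using assms(2)
  proof (induction v arbitrary: w)
    case (Cons s v)
    then show ?case using assms(1)[of w] out_eq[of A w s] by (cases s) (auto simp: word_act_Cons)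
  qed simp
qed

text \<open>The second assumption is the invariant of the search: sections of finished words are
  finished or pending. Once nothing is pending, the finished words form a closed set of inactive
  words.\<close>

lemma explore_True:
  assumes "explore A n done todo = Some True"
    and "\<And>w. w \<in> set done \<Longrightarrow> \<not> out A w False \<and> section_word A w False \<in> set done \<union> set todo
      \<and> section_word A w True \<in> set done \<union> set todo"
    and "w \<in> set done \<union> set todo"
  shows "word_act A w = id"
  using assms
proof (induction A n "done" todo arbitrary: w rule: explore.induct)
  case (2 A n "done")
  then show ?case using sections_closed_trivial[of "set done"] by auto
next
  case (3 A n "done" v todo)
  show ?case
  proof (cases "v \<in> set done")
    case True
    then show ?thesis using 3 by (auto simp: insert_absorb)
  next
    case False
    then have "\<not> out A v False" using 3(3) by (auto split: if_splits)
    then show ?thesis using 3(2)[OF False] 3(3-5) False by (simp split: if_splits) blast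
  qed
qed simp

lemma explore_False:
  assumes "explore A n done todo = Some False"
  shows "\<exists>w\<in>set todo. word_act A w \<noteq> id"
  using assms
proof (induction A n "done" todo rule: explore.induct)
  case (3 A n "done" v todo)
  consider "v \<in> set done" | "v \<notin> set done" "out A v False" | "v \<notin> set done" "\<not> out A v False" by blast
  then show ?case
  proof cases
    case 1
    then show ?thesis using 3 by simp
  next
    case 2
    then have "word_act A v \<noteq> id" using word_act_eq_id_iff[of A v] by blast
    then show ?thesis by (meson list.set_intros(1))
  next
    case 3
    then have "explore A n (v # done) (section_word A v False # section_word A v True # todo) = Some False"
      using "3.prems" by simp
    with "3.IH"(2) 3
    have "\<exists>w\<in>set (section_word A v False # section_word A v True # todo). word_act A w \<noteq> id"
      by blast
    moreover have "word_act A v \<noteq> id" if "word_act A (section_word A v s) \<noteq> id" for s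
      using that word_act_eq_id_iff[of A v] by blast
    ultimately show ?thesis by (metis list.set_intros(1) list.set_intros(2) set_ConsD)
  qed
qed simp_all

text \<open>The fuel 80 bounds the number of search steps; it is large enough for the computations
  of the classification to succeed.\<close>

definition trivial_word :: "automaton \<Rightarrow> state signed list \<Rightarrow> bool" where
  "trivial_word A w \<longleftrightarrow> explore A 80 [] [w] = Some True"

definition nontrivial_word :: "automaton \<Rightarrow> state signed list \<Rightarrow> bool" where
  "nontrivial_word A w \<longleftrightarrow> explore A 80 [] [w] = Some False"

lemma trivial_wordD: "trivial_word A w \<Longrightarrow> word_act A w = id"
  unfolding trivial_word_def by (rule explore_True) auto

lemma nontrivial_wordD: "nontrivial_word A w \<Longrightarrow> word_act A w \<noteq> id"
  unfolding nontrivial_word_def by (auto dest: explore_False)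

section \<open>Computable tests for the four obstructions\<close>

definition commuting_test :: "automaton \<Rightarrow> bool" where
  "commuting_test A \<longleftrightarrow> (\<forall>(q, r) \<in> set [(Sa, Sb), (Sa, Sc), (Sb, Sc)].
     trivial_word A [(True, q), (True, r), (False, q), (False, r)])"

definition torsion_test :: "automaton \<Rightarrow> state signed list \<Rightarrow> bool" where
  "torsion_test A w \<longleftrightarrow> nontrivial_word A w \<and> trivial_word A (w @ w)"

text \<open>Over two letters, \<open>\<not> out A w False\<close> already says that \<open>w\<close>
  fixes both of them.\<close>

definition section_test :: "automaton \<Rightarrow> state signed list \<Rightarrow> bool" where
  "section_test A w \<longleftrightarrow> \<not> out A w False \<and> nontrivial_word A w \<and>
     (trivial_word A (section_word A w False) \<or> trivial_word A (section_word A w True))"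

definition expansion_test :: "automaton \<Rightarrow> state signed list \<Rightarrow> state signed list \<Rightarrow> bool" where
  "expansion_test A v w \<longleftrightarrow> nontrivial_word A v \<and>
     (trivial_word A ((v @ w) @ inv_word (w @ v @ v @ v)) \<or> trivial_word A ((v @ w @ v @ v @ v) @ inv_word w))"

lemma commuting_test:
  assumes "commuting_test A"
  shows "comm_group (automaton_group A)"
proof (rule commuting_generators_comm_group)
  have *: "act A q \<circ> act A r = act A r \<circ> act A q" if "(q, r) \<in> set [(Sa, Sb), (Sa, Sc), (Sb, Sc)]" for q r
  proof -
    have "trivial_word A [(True, q), (True, r), (False, q), (False, r)]"
      using assms that unfolding commuting_test_def by blast
    then have "word_act A ([(True, q), (True, r)] @ inv_word [(True, r), (True, q)]) = id"
      by (simp add: trivial_wordD inv_word_def inv_letter_def del: word_act.simps)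
    from this[folded word_act_eq_iff] show ?thesis by (simp add: letter_act_def)
  qed
  show "act A q \<circ> act A r = act A r \<circ> act A q" for q r
    using *[of Sa Sb] *[of Sa Sc] *[of Sb Sc] by (cases q; cases r) simp_all
qed

lemma torsion_test:
  assumes "torsion_test A w"
  shows "\<not> is_free_group (automaton_group A)"
proof
  assume "is_free_group (automaton_group A)"
  moreover have "word_act A w ^^ 2 = id"
    using assms trivial_wordD[of A "w @ w"] by (simp add: torsion_test_def word_act_append numeral_2_eq_2)
  ultimately show False
    using free_automaton_group_torsion_free[of A 2 w] assms nontrivial_wordD[of A w]
    by (simp add: torsion_test_def)
qed

lemma section_test:
  assumes "section_test A w" "fst (A q)"
  shows "\<not> is_free_group (automaton_group A)"
proof -
  have "word_act A w \<noteq> id" "out A w s = s" for s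
    using assms(1) nontrivial_wordD out_eq[of A w s] by (auto simp: section_test_def)
  moreover obtain s where "word_act A (section_word A w s) = id"
    using assms(1) trivial_wordD by (auto simp: section_test_def)
  ultimately show ?thesis using trivial_section_not_free[of A q w s] assms(2) by blast
qed

lemma expansion_test:
  assumes "expansion_test A v w"
  shows "\<not> is_free_group (automaton_group A)"
proof
  assume free: "is_free_group (automaton_group A)"
  have "word_act A (v @ w) = word_act A (w @ v @ v @ v) \<or> word_act A (v @ w @ v @ v @ v) = word_act A w"
    using assms unfolding expansion_test_def word_act_eq_iff by (blast intro: trivial_wordD)
  then have "word_act A v = id"
    by (intro free_automaton_group_no_expansion[OF free, of v w 3])
      (auto simp: word_act_append numeral_3_eq_3 comp_assoc)
  then show False using assms nontrivial_wordD by (auto simp: expansion_test_def)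
qed

section \<open>Classification\<close>

definition make_automaton :: "bool \<times> state \<times> state \<Rightarrow> bool \<times> state \<times> state \<Rightarrow> bool \<times> state \<times> state \<Rightarrow> automaton" where
  "make_automaton x y z = case_state x y z"

text \<open>The words were found by a computer search for a small family that covers all automata below.\<close>

definition not_free_test :: "automaton \<Rightarrow> bool" where
  "not_free_test A \<longleftrightarrow>
     torsion_test A [(True, Sc)] \<or> section_test A [(False, Sc), (True, Sb)] \<or> commuting_test A \<or>
     list_ex (torsion_test A)
      [[(False, Sc), (True, Sa)], [(False, Sb), (True, Sa)], [(False, Sc), (True, Sb)]] \<or>
     list_ex (section_test A)
      [[(False, Sc), (True, Sb), (False, Sc), (True, Sa)],
       [(False, Sc), (True, Sa), (False, Sb), (True, Sa)],
       [(False, Sc), (False, Sa), (True, Sc), (True, Sa)],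
       [(False, Sb), (False, Sa), (True, Sb), (True, Sa)],
       [(False, Sb), (False, Sc), (True, Sa), (True, Sa)],
       [(False, Sc), (False, Sb), (True, Sc), (True, Sa)]] \<or>
     expansion_test A [(False, Sb), (True, Sa)] [(False, Sa)] \<or>
     expansion_test A [(False, Sb), (True, Sa)] [(True, Sa)] \<or>
     list_ex (section_test A)
      [[(False, Sc), (True, Sb), (True, Sb), (True, Sb)],
       [(True, Sc), (False, Sb), (True, Sc), (True, Sb)],
       [(False, Sc), (False, Sc), (False, Sc), (True, Sb)],
       [(False, Sc), (False, Sb), (True, Sa), (True, Sa)],
       [(True, Sc), (False, Sb), (False, Sc), (True, Sa)],
       [(False, Sc), (True, Sb), (True, Sc), (True, Sb)]]"

text \<open>Exchanging the letters orders the successors of \<open>Sa\<close>, and inverting then orders those of an active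
  state while those of an inactive one stay.\<close>

definition ordered_pairs :: "(state \<times> state) list" where
  "ordered_pairs = [(Sa, Sa), (Sa, Sb), (Sa, Sc), (Sb, Sb), (Sb, Sc), (Sc, Sc)]"

definition state_pairs :: "(state \<times> state) list" where
  "state_pairs = [(Sa, Sa), (Sa, Sb), (Sa, Sc), (Sb, Sa), (Sb, Sb), (Sb, Sc), (Sc, Sa), (Sc, Sb), (Sc, Sc)]"

lemma not_free_test:
  assumes "not_free_test A" "fst (A q)"
  shows "\<not> free_nonabelian A"
  using assms commuting_test torsion_test section_test[of A _ q] expansion_test
  unfolding not_free_test_def free_nonabelian_def list_ex_iff by meson

lemma not_free_one_active:
  "list_all (\<lambda>a. list_all (\<lambda>b. list_all (\<lambda>c. not_free_test (make_automaton (False, a) (False, b) (True, c)))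
    ordered_pairs) state_pairs) ordered_pairs"
  by code_simp

text \<open>The two exceptions are the normal forms that belong to the Aleshin-Vorobets
  automaton.\<close>

lemma not_free_two_active:
  "list_all (\<lambda>a. list_all (\<lambda>b. list_all (\<lambda>c. not_free_test (make_automaton (False, a) (True, b) (True, c)) \<or>
      (a, b, c) = ((Sb, Sb), (Sa, Sc), (Sc, Sa)) \<or> (a, b, c) = ((Sc, Sc), (Sa, Sb), (Sb, Sa)))
    state_pairs) ordered_pairs) ordered_pairs"
  by code_simp

lemma symmetric_automata_step:
  "symmetric_automata A (inverse_automaton A)" "symmetric_automata A (swap_letters A)"
  "bij \<pi> \<Longrightarrow> symmetric_automata A (rename_states \<pi> A)"
  unfolding symmetric_automata_def
  by (auto intro: symmetry_step.intros r_into_rtranclp)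

lemma symmetric_automata_trans:
  "symmetric_automata A B \<Longrightarrow> symmetric_automata B C \<Longrightarrow> symmetric_automata A C"
  unfolding symmetric_automata_def by (rule rtranclp_trans)

lemma make_automaton_simps [simp]:
  "make_automaton x y z Sa = x" "make_automaton x y z Sb = y" "make_automaton x y z Sc = z"
  by (simp_all add: make_automaton_def)

lemma automaton_eqI:
  assumes "A Sa = B Sa" "A Sb = B Sb" "A Sc = B Sc"
  shows "A = (B :: automaton)"
proof
  fix q show "A q = B q" using assms by (cases q) simp_all
qed

lemma mem_state_pairs: "p \<in> set state_pairs"
  by (cases p; cases "fst p"; cases "snd p") (auto simp: state_pairs_def)

lemma mem_ordered_pairs: "p \<in> set ordered_pairs \<or> prod.swap p \<in> set ordered_pairs"
  by (cases p; cases "fst p"; cases "snd p") (auto simp: ordered_pairs_def)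

lemma swap_letters_make_automaton:
  "swap_letters (make_automaton (i, a) (j, b) (k, c)) =
    make_automaton (i, prod.swap a) (j, prod.swap b) (k, prod.swap c)"
  by (rule automaton_eqI) (auto simp: swap_letters_def prod.swap_def split: prod.splits)

lemma inverse_automaton_make_automaton:
  "inverse_automaton (make_automaton (i, a) (j, b) (k, c)) =
    make_automaton (i, if i then prod.swap a else a) (j, if j then prod.swap b else b) (k, if k then prod.swap c else c)"
  by (rule automaton_eqI) (auto simp: inverse_automaton_def prod.swap_def split: prod.splits)

definition aleshin_vorobets_or_not_free :: "automaton \<Rightarrow> bool" where
  "aleshin_vorobets_or_not_free A \<longleftrightarrow> (free_nonabelian A \<longrightarrow> symmetric_automata A aleshin_vorobets)"

lemma aleshin_vorobets_or_not_free_symmetric: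
  assumes "symmetric_automata A B" "aleshin_vorobets_or_not_free B"
  shows "aleshin_vorobets_or_not_free A"
  using assms free_nonabelian_iso[OF symmetric_automata_iso] symmetric_automata_trans
  unfolding aleshin_vorobets_or_not_free_def by blast

text \<open>Exchanging \<open>Sa\<close> and \<open>Sc\<close> makes \<open>Sa\<close> the inactive
  state, which gives the first exception; exchanging \<open>Sb\<close> and \<open>Sc\<close> and
  then the letters turns it into the second.\<close>

lemma aleshin_vorobets_variants:
  "symmetric_automata (make_automaton (False, Sc, Sc) (True, Sa, Sb) (True, Sb, Sa)) aleshin_vorobets"
  "symmetric_automata (make_automaton (False, Sb, Sb) (True, Sa, Sc) (True, Sc, Sa)) aleshin_vorobets"
proof -
  let ?A = "make_automaton (False, Sc, Sc) (True, Sa, Sb) (True, Sb, Sa)"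
  let ?B = "make_automaton (False, Sb, Sb) (True, Sa, Sc) (True, Sc, Sa)"
  have "?A = rename_states (transpose Sa Sc) aleshin_vorobets"
    by (rule automaton_eqI) (simp_all add: rename_states_def transpose_def)
  then show A: "symmetric_automata ?A aleshin_vorobets"
    using symmetric_automata_sym[OF symmetric_automata_step(3)[of "transpose Sa Sc"]] by simp
  have "?B = swap_letters (rename_states (transpose Sb Sc) ?A)"
    by (rule automaton_eqI) (simp_all add: rename_states_def transpose_def swap_letters_def)
  then have "symmetric_automata ?A ?B"
    using symmetric_automata_trans[OF symmetric_automata_step(3)[of "transpose Sb Sc"] symmetric_automata_step(2)] by simp
  then show "symmetric_automata ?B aleshin_vorobets"
    using A symmetric_automata_sym symmetric_automata_trans by blast
qed

lemma aleshin_vorobets_or_not_free_one_active: "aleshin_vorobets_or_not_free (make_automaton (False, a) (False, b) (True, c))"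
proof -
  have 1: "aleshin_vorobets_or_not_free (make_automaton (False, a) (False, b) (True, c))"
    if "a \<in> set ordered_pairs" "c \<in> set ordered_pairs" for a b c
  proof -
    have "not_free_test (make_automaton (False, a) (False, b) (True, c))"
      using not_free_one_active that mem_state_pairs[of b] by (simp add: list_all_iff)
    then show ?thesis using not_free_test[of _ Sc] by (simp add: aleshin_vorobets_or_not_free_def)
  qed
  have 2: "aleshin_vorobets_or_not_free (make_automaton (False, a) (False, b) (True, c))"
    if "a \<in> set ordered_pairs" for a b c
    using mem_ordered_pairs[of c] 1[OF that, of c b] 1[OF that, of "prod.swap c" b]
      aleshin_vorobets_or_not_free_symmetric[OF symmetric_automata_step(1), of "make_automaton (False, a) (False, b) (True, c)"]
    unfolding inverse_automaton_make_automaton by auto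
  show ?thesis
    using mem_ordered_pairs[of a] 2[of a b c] 2[of "prod.swap a" "prod.swap b" "prod.swap c"]
      aleshin_vorobets_or_not_free_symmetric[OF symmetric_automata_step(2), of "make_automaton (False, a) (False, b) (True, c)"]
    unfolding swap_letters_make_automaton by auto
qed

lemma aleshin_vorobets_or_not_free_two_active: "aleshin_vorobets_or_not_free (make_automaton (False, a) (True, b) (True, c))"
proof -
  have 1: "aleshin_vorobets_or_not_free (make_automaton (False, a) (True, b) (True, c))"
    if "a \<in> set ordered_pairs" "b \<in> set ordered_pairs" for a b c
  proof -
    have "not_free_test (make_automaton (False, a) (True, b) (True, c)) \<or>
      (a, b, c) = ((Sb, Sb), (Sa, Sc), (Sc, Sa)) \<or> (a, b, c) = ((Sc, Sc), (Sa, Sb), (Sb, Sa))"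
      using not_free_two_active that mem_state_pairs[of c] unfolding list_all_iff by blast
    then show ?thesis using not_free_test[of _ Sc] aleshin_vorobets_variants
      by (auto simp: aleshin_vorobets_or_not_free_def)
  qed
  \<comment> \<open>Inversion reverses the successors of both active states and keeps the order of
    \<open>a\<close>. It can order \<open>b\<close>, while \<open>c\<close> has to remain
    arbitrary.\<close>
  have 2: "aleshin_vorobets_or_not_free (make_automaton (False, a) (True, b) (True, c))"
    if "a \<in> set ordered_pairs" for a b c
    using mem_ordered_pairs[of b] 1[OF that, of b c] 1[OF that, of "prod.swap b" "prod.swap c"]
      aleshin_vorobets_or_not_free_symmetric[OF symmetric_automata_step(1), of "make_automaton (False, a) (True, b) (True, c)"]
    unfolding inverse_automaton_make_automaton by auto
  show ?thesis
    using mem_ordered_pairs[of a] 2[of a b c] 2[of "prod.swap a" "prod.swap b" "prod.swap c"]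
      aleshin_vorobets_or_not_free_symmetric[OF symmetric_automata_step(2), of "make_automaton (False, a) (True, b) (True, c)"]
    unfolding swap_letters_make_automaton by auto
qed

text \<open>All states act by the same letterwise map, so the generators commute.\<close>

lemma aleshin_vorobets_or_not_free_equal_activity:
  assumes "\<And>q. fst (A q) = i"
  shows "aleshin_vorobets_or_not_free A"
proof -
  have "act A q w = map (\<lambda>x. if i then \<not> x else x) w" for q w
    by (induction w arbitrary: q) (use assms in \<open>auto split: prod.splits, (metis fst_conv)+\<close>)
  then have "act A q = act A r" for q r by (simp add: fun_eq_iff)
  then have "comm_group (automaton_group A)"
    by (intro commuting_generators_comm_group) metis
  then show ?thesis by (simp add: aleshin_vorobets_or_not_free_def free_nonabelian_def)
qed

theorem aleshin_vorobets_or_not_free: "aleshin_vorobets_or_not_free A"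
proof -
  have canonical: "aleshin_vorobets_or_not_free A" if "\<not> fst (A Sa)" "fst (A Sc)" for A
  proof -
    have A: "A = make_automaton (False, snd (A Sa)) (fst (A Sb), snd (A Sb)) (True, snd (A Sc))"
      using that by (intro automaton_eqI) (simp_all add: prod_eq_iff)
    show ?thesis
    proof (cases "fst (A Sb)")
      case True
      then show ?thesis using aleshin_vorobets_or_not_free_two_active[of "snd (A Sa)" "snd (A Sb)" "snd (A Sc)"] A by simp
    next
      case False
      then show ?thesis using aleshin_vorobets_or_not_free_one_active[of "snd (A Sa)" "snd (A Sb)" "snd (A Sc)"] A by simp
    qed
  qed
  \<comment> \<open>If the activities are not all equal, at most one transposition of states makes
    \<open>Sa\<close> inactive and \<open>Sc\<close> active.\<close>
  have rename: "aleshin_vorobets_or_not_free A" if "\<not> fst (A (transpose p q Sa))" "fst (A (transpose p q Sc))" for p q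
    by (rule aleshin_vorobets_or_not_free_symmetric[OF symmetric_automata_step(3)[of "transpose p q"]], simp, rule canonical)
      (use that in \<open>auto simp: rename_states_def split: prod.splits\<close>)
  consider "fst (A Sb) = fst (A Sa)" "fst (A Sc) = fst (A Sa)" | "fst (A Sa) \<noteq> fst (A Sc)" | "fst (A Sa) = fst (A Sc)" "fst (A Sb) \<noteq> fst (A Sa)"
    by blast
  then show ?thesis
  proof cases
    case 1
    then have "fst (A q) = fst (A Sa)" for q by (cases q) simp_all
    then show ?thesis by (rule aleshin_vorobets_or_not_free_equal_activity)
  next
    case 2
    then show ?thesis using canonical[of A] rename[of Sa Sc] by (auto simp: transpose_def)
  next
    case 3
    then show ?thesis using rename[of Sa Sb] rename[of Sb Sc] by (auto simp: transpose_def)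
  qed
qed

theorem theorem4:
  "(is_free_group (automaton_group aleshin_vorobets)
      \<and> \<not> comm_group (automaton_group aleshin_vorobets)
      \<and> automaton_group aleshin_vorobets \<cong> free_group {..<3::nat})
   \<and> (\<forall>A :: automaton. is_free_group (automaton_group A) \<and> \<not> comm_group (automaton_group A)
        \<longrightarrow> automaton_group A \<cong> free_group {..<3::nat})
   \<and> (\<forall>A :: automaton. automaton_group A \<cong> automaton_group aleshin_vorobets
        \<longleftrightarrow> symmetric_automata A aleshin_vorobets)"
proof (intro conjI allI impI)
  show "is_free_group (automaton_group aleshin_vorobets)" "\<not> comm_group (automaton_group aleshin_vorobets)"
    using free_nonabelian_aleshin_vorobets(1) by (simp_all add: free_nonabelian_def)
  show "automaton_group aleshin_vorobets \<cong> free_group {..<3::nat}"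
    by (rule free_nonabelian_aleshin_vorobets(2))
next
  fix A assume "is_free_group (automaton_group A) \<and> \<not> comm_group (automaton_group A)"
  then have "symmetric_automata A aleshin_vorobets"
    using aleshin_vorobets_or_not_free[of A]
    by (simp add: aleshin_vorobets_or_not_free_def free_nonabelian_def)
  from iso_trans[OF symmetric_automata_iso[OF this] free_nonabelian_aleshin_vorobets(2)]
  show "automaton_group A \<cong> free_group {..<3::nat}" .
next
  fix A show "automaton_group A \<cong> automaton_group aleshin_vorobets \<longleftrightarrow> symmetric_automata A aleshin_vorobets"
  proof
    \<comment> \<open>The isomorphism carries freeness and noncommutativity over to the group of
      \<open>A\<close>, so the classification applies to \<open>A\<close>.\<close>
    assume "automaton_group A \<cong> automaton_group aleshin_vorobets"
    then have "automaton_group aleshin_vorobets \<cong> automaton_group A"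
      by (rule group.iso_sym[OF group_automaton_group])
    from free_nonabelian_iso[OF this free_nonabelian_aleshin_vorobets(1)]
    show "symmetric_automata A aleshin_vorobets"
      using aleshin_vorobets_or_not_free[of A] by (simp add: aleshin_vorobets_or_not_free_def)
  qed (rule symmetric_automata_iso)
qed

end
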